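(* Consider $\min_{x\in\mathbb{R}^d} f(x)=\frac1n\sum_{i=1}^n f_i(x)$, where each $f_i$ is convex and $L$-smooth and is supported on the coordinate set $T_i\subseteq\{1,\dots,d\}$, and $f$ satisfies the quadratic growth condition $f(x)-f(x^\star)\ge\frac{\mu}{2}\|x-x^\star\|^2$ for all $x\in\mathbb{R}^d$ with $\mu>0$ (in particular, this holds if $f$ is $\mu$-strongly convex), where $x^\star$ is the minimizer of $f$. Let $\kappa=L/\mu$ and $\Delta=\frac1n\max_{v\in\{1,\dots,d\}}|\{i: v\in T_i\}|$. Suppose that the asynchronous algorithm AS-Acc-SVRG (defined in the context) is run under the unbiasedness assumption and the bounded overlaps assumption with bound $\tau$ (both stated in the context). Let $\omega>1$ be a constant and suppose $$\tau\le O\left(\frac{1}{\sqrt\Delta}\max\left\{\frac n\kappa,1\right\}\right).$$ Set $\widetilde\tau\ge\tau$ with $\widetilde\tau=O\left(\frac{1}{\sqrt\Delta}\max\left\{\frac n\kappa,1\right\}\right)$, and choose $m=\Theta(n)$ and $$\vartheta=\frac{\sqrt m}{\sqrt{\kappa(1+2\sqrt\Delta\,\widetilde\tau)}+\sqrt m},\quad \varphi=\frac{1-\vartheta}{L},\quad \eta=\frac{1-\vartheta}{L\vartheta(1+2\sqrt\Delta\,\widetilde\tau)},\quad S=\left\lceil 2\omega\sqrt{\frac{\kappa}{m}\big(1+2\sqrt\Delta\,\widetilde\tau\big)}\right\rceil .$$ Then $S=O\left(\max\left\{1,\sqrt{\frac{\kappa}{n}}\right\}\right)$, and for any accuracy $\epsilon>0$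 and any initial point $x_0$, with a suitable number of restart rounds $R=O\big(\log\frac{f(x_0)-f(x^\star)}{\epsilon}\big)$, AS-Acc-SVRG run with these parameters from $x_0$ outputs $x_R$ satisfying $\mathbb{E}[f(x_R)]-f(x^\star)\le\epsilon$, with total oracle complexity $$R\cdot S\cdot(n+2m)=O\left(\max\left\{n,\sqrt{\kappa n}\right\}\log\frac{f(x_0)-f(x^\star)}{\epsilon}\right).$$
   Context: Setting. $\|\cdot\|$ and $\langle\cdot,\cdot\rangle$ are the Euclidean norm and inner product. A function $g$ is $L$-smooth if $\|\nabla g(x)-\nabla g(y)\|\le L\|x-y\|$ for all $x,y$. "$f_i$ is supported on $T_i$" means that $f_i(x)$ depends only on the coordinates of $x$ in $T_i$ (so $\nabla f_i$ depends only on these coordinates and vanishes outside $T_i$). Every coordinate $v\in\{1,\dots,d\}$ belongs to at least one $T_i$. $P_i\in\mathbb{R}^{d\times d}$ is the diagonal projection matrix onto the coordinates in $T_i$, $D=\big(\frac1n\sum_{i=1}^nP_i\big)^{-1}$ and $D_i=P_iD$. $(\alpha)_+=\max\{\alpha,0\}$. Algorithm AS-Acc-SVRG (Asynchronous Sparse Accelerated SVRG), with input $x_0$, parameters $m,\vartheta,\varphi,\eta,S,R$, and a shared variable $z$. For $r=0,\dots,R-1$: set $\tilde x_0=z=x_r$; for $s=0,\dots,S-1$ (an epoch): compute $\nabla f(\tilde x_s)$; then, in parallel and without locks, until $m$ samples have been processed, each worker repeatedly samples $i$ uniformly from $\{1,\dots,n\}$, makes an inconsistent read $\hat z$ of $z$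 (on $T_i$), forms $\hat y=\vartheta\hat z+(1-\vartheta)\tilde x_s-\varphi D\nabla f(\tilde x_s)$ (on $T_i$), and adds $-\eta\big(\nabla f_i(\hat y)-\nabla f_i(\tilde x_s)+D_i\nabla f(\tilde x_s)\big)$ to $z$ coordinate by coordinate for $v\in T_i$, with atomic coordinate-wise writes. After the epoch, $\tilde x_{s+1}$ is chosen uniformly at random among the $m$ inconsistent points $\hat y$ of the epoch, and $z$ is left unchanged. After the $S$ epochs, $x_{r+1}=\frac1S\sum_{s=0}^{S-1}\tilde x_{s+1}$. The output is $x_R$. Mathematical model of one epoch (perturbed iterates). The updates are indexed by $k=0,\dots,m-1$, the counter being increased after each inconsistent read is completed, so that $\hat z_k$ does not depend on the samples $i_r$ with $r>k$. The samples $i_k$ are uniform on $\{1,\dots,n\}$, drawn independently. With $$\hat y_k=\vartheta\hat z_k+(1-\vartheta)\tilde x_s-\varphi D\nabla f(\tilde x_s),\qquad \mathcal{G}_{\hat y_k}=\nabla f_{i_k}(\hat y_k)-\nabla f_{i_k}(\tilde x_s)+D_{i_k}\nabla f(\tilde x_s),$$ the virtual iterates are $z_{k+1}=z_k-\eta\,\mathcal{G}_{\hat y_k}$, where $z_0$ is the content of the shared variable at the start of the epoch, and $z_m$ is its content at the end of the epoch (hence the $z_0$ of the next epoch in the same round). The snapshot $\tilde x_{s+1}$ is uniform on $\{\hat y_0,\dots,\hat y_{m-1}\}$. Unbiasedness assumption: $\hat z_k$ is independent of the sample $i_k$; thus $\mathbb{E}[\mathcal{G}_{\hat y_k}\mid\hat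 z_k]=\nabla f(\hat y_k)$. Bounded overlaps assumption: there is a uniform bound $\tau$ on the maximum number of iterations that can overlap together; the effect of asynchrony is modeled as $$\hat z_k=z_k+\eta\sum_{j=(k-\tau)_+}^{k-1}J_j^k\,\mathcal{G}_{\hat y_j},$$ where each $J_j^k$ is a diagonal matrix with entries in $\{0,1\}$ (an entry $1$ meaning that $\hat z_k$ lacks the $j$-th update on that coordinate). Oracle complexity is the number of incremental gradient computations (evaluations of some $\nabla f_i$ at a point) performed; for this algorithm it is counted as $R\cdot S\cdot(n+2m)$. $\mathbb{E}$ is total expectation. The constants hidden in the conclusions' $O(\cdot)$ may depend on $\omega$, on the constants in $m=\Theta(n)$, and on the constant in the $O(\cdot)$ bound for $\widetilde\tau$ only; a logarithmic factor inside $O(\cdot)$ is understood, as usual, as being at least a positive constant. *)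

theory Defs
  imports "HOL-Probability.Probability"
begin

definition gradient :: "('a::real_inner \<Rightarrow> real) \<Rightarrow> 'a \<Rightarrow> 'a" where
  "gradient g x = (THE D. GDERIV g x :> D)"

definition L_smooth :: "real \<Rightarrow> ('a::real_inner \<Rightarrow> real) \<Rightarrow> bool" where
  "L_smooth L g \<longleftrightarrow>
     (\<forall>x. \<exists>D. GDERIV g x :> D) \<and>
     (\<forall>x y. norm (gradient g x - gradient g y) \<le> L * norm (x - y))"

definition supported_on :: "'d set \<Rightarrow> (real ^ 'd \<Rightarrow> real) \<Rightarrow> bool" where
  "supported_on A g \<longleftrightarrow> (\<forall>x y. (\<forall>v\<in>A. x $ v = y $ v) \<longrightarrow> g x = g y)"

definition mean_fun :: "nat \<Rightarrow> (nat \<Rightarrow> 'a \<Rightarrow> real) \<Rightarrow> 'a \<Rightarrow> real" where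
  "mean_fun n f x = (1 / real n) * (\<Sum>i=1..n. f i x)"

text \<open>The matrices \<open>P\<^sub>i\<close> (for \<open>A = T i\<close>) and \<open>D\<close>, and the number \<open>\<Delta>\<close>.\<close>

definition coord_proj :: "'d set \<Rightarrow> real ^ 'd ^ 'd" where
  "coord_proj A = (\<chi> v w. if v = w \<and> v \<in> A then 1 else 0)"

definition reweight :: "nat \<Rightarrow> (nat \<Rightarrow> 'd::finite set) \<Rightarrow> real ^ 'd ^ 'd" where
  "reweight n T = matrix_inv ((1 / real n) *\<^sub>R (\<Sum>i=1..n. coord_proj (T i)))"

definition max_overlap :: "nat \<Rightarrow> (nat \<Rightarrow> 'd::finite set) \<Rightarrow> real" where
  "max_overlap n T = (1 / real n) * real (Max (range (\<lambda>v. card {i \<in> {1..n}. v \<in> T i})))"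

definition zero_one_diagonal :: "real ^ 'd ^ 'd \<Rightarrow> bool" where
  "zero_one_diagonal A \<longleftrightarrow> (\<forall>v w. A $ v $ w \<in> {0, 1} \<and> (v \<noteq> w \<longrightarrow> A $ v $ w = 0))"

text \<open>
  A run consists of random variables on an arbitrary probability space \<open>M\<close>, indexed by the round
  \<open>r < R\<close>, the epoch \<open>s < S\<close> and the update \<open>k < m\<close>:
  \<open>idx r s k\<close> is the sample \<open>i\<^sub>k\<close>, \<open>pick r s\<close> is the position of the next snapshot among
  the points \<open>yhat r s 0, \<dots>, yhat r s (m - 1)\<close>, \<open>xt r s\<close> is the snapshot used in epoch \<open>s\<close>,
  and \<open>G r s k\<close> is the stochastic gradient at \<open>yhat r s k\<close>.

  \<open>\<F> r s k\<close> is the information available when the read \<open>zhat r s k\<close> is completed: all earlier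
  reads, samples and snapshot picks, but not the sample \<open>idx r s k\<close>. At \<open>k = m\<close> it is
  the information at the end of the epoch, before the next snapshot is picked. A sample or pick is
  drawn independently of that information. Since \<open>zhat r s k\<close> is measurable with respect to
  \<open>\<F> r s k\<close>, this contains the unbiasedness assumption.

  The matrices \<open>J r s k j\<close> may depend on the outcome in an arbitrary way.
\<close>

locale AS_Acc_SVRG = prob_space M
  for M :: "'w measure" +
  fixes f :: "nat \<Rightarrow> real ^ 'd::finite \<Rightarrow> real"
    and n :: nat
    and T :: "nat \<Rightarrow> 'd set"
    and m \<tau> :: nat
    and \<theta> \<phi> \<eta> :: real
    and S R :: nat
    and x0 :: "real ^ 'd"
    and \<F> :: "nat \<Rightarrow> nat \<Rightarrow> nat \<Rightarrow> 'w measure"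
    and idx :: "nat \<Rightarrow> nat \<Rightarrow> nat \<Rightarrow> 'w \<Rightarrow> nat"
    and pick :: "nat \<Rightarrow> nat \<Rightarrow> 'w \<Rightarrow> nat"
    and J :: "nat \<Rightarrow> nat \<Rightarrow> nat \<Rightarrow> nat \<Rightarrow> 'w \<Rightarrow> real ^ 'd ^ 'd"
    and zhat yhat G z :: "nat \<Rightarrow> nat \<Rightarrow> nat \<Rightarrow> 'w \<Rightarrow> real ^ 'd"
    and xt :: "nat \<Rightarrow> nat \<Rightarrow> 'w \<Rightarrow> real ^ 'd"
    and x :: "nat \<Rightarrow> 'w \<Rightarrow> real ^ 'd"
  assumes x_0: "\<And>\<xi>. \<xi> \<in> space M \<Longrightarrow> x 0 \<xi> = x0"
    and round_start: "\<And>r \<xi>. r < R \<Longrightarrow> \<xi> \<in> space M \<Longrightarrow> xt r 0 \<xi> = x r \<xi> \<and> z r 0 0 \<xi> = x r \<xi>"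
    and yhat_eq: "\<And>r s k \<xi>. r < R \<Longrightarrow> s < S \<Longrightarrow> k < m \<Longrightarrow> \<xi> \<in> space M \<Longrightarrow>
      yhat r s k \<xi> = \<theta> *\<^sub>R zhat r s k \<xi> + (1 - \<theta>) *\<^sub>R xt r s \<xi>
        - \<phi> *\<^sub>R (reweight n T *v gradient (mean_fun n f) (xt r s \<xi>))"
    and G_eq: "\<And>r s k \<xi>. r < R \<Longrightarrow> s < S \<Longrightarrow> k < m \<Longrightarrow> \<xi> \<in> space M \<Longrightarrow>
      G r s k \<xi> = gradient (f (idx r s k \<xi>)) (yhat r s k \<xi>)
        - gradient (f (idx r s k \<xi>)) (xt r s \<xi>)
        + (coord_proj (T (idx r s k \<xi>)) ** reweight n T) *v gradient (mean_fun n f) (xt r s \<xi>)"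
    and z_Suc: "\<And>r s k \<xi>. r < R \<Longrightarrow> s < S \<Longrightarrow> k < m \<Longrightarrow> \<xi> \<in> space M \<Longrightarrow>
      z r s (Suc k) \<xi> = z r s k \<xi> - \<eta> *\<^sub>R G r s k \<xi>"
    and z_next_epoch: "\<And>r s \<xi>. r < R \<Longrightarrow> Suc s < S \<Longrightarrow> \<xi> \<in> space M \<Longrightarrow>
      z r (Suc s) 0 \<xi> = z r s m \<xi>"
    and snapshot: "\<And>r s \<xi>. r < R \<Longrightarrow> s < S \<Longrightarrow> \<xi> \<in> space M \<Longrightarrow>
      xt r (Suc s) \<xi> = yhat r s (pick r s \<xi>) \<xi>"
    and x_Suc: "\<And>r \<xi>. r < R \<Longrightarrow> \<xi> \<in> space M \<Longrightarrow>
      x (Suc r) \<xi> = (1 / real S) *\<^sub>R (\<Sum>s<S. xt r (Suc s) \<xi>)"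
  \<comment> \<open>natural-number subtraction gives the positive part of \<open>k - \<tau>\<close>\<close>
    and J_zero_one: "\<And>r s k j \<xi>. r < R \<Longrightarrow> s < S \<Longrightarrow> k < m \<Longrightarrow> j \<in> {k - \<tau>..<k} \<Longrightarrow> \<xi> \<in> space M \<Longrightarrow>
      zero_one_diagonal (J r s k j \<xi>)"
    and zhat_eq: "\<And>r s k \<xi>. r < R \<Longrightarrow> s < S \<Longrightarrow> k < m \<Longrightarrow> \<xi> \<in> space M \<Longrightarrow>
      zhat r s k \<xi> = z r s k \<xi> + \<eta> *\<^sub>R (\<Sum>j\<in>{k - \<tau>..<k}. J r s k j \<xi> *v G r s j \<xi>)"
    and \<F>_subalgebra: "\<And>r s k. r < R \<Longrightarrow> s < S \<Longrightarrow> k \<le> m \<Longrightarrow> subalgebra M (\<F> r s k)"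
    and \<F>_update: "\<And>r s k. r < R \<Longrightarrow> s < S \<Longrightarrow> k < m \<Longrightarrow> subalgebra (\<F> r s (Suc k)) (\<F> r s k)"
    and \<F>_epoch: "\<And>r s. r < R \<Longrightarrow> Suc s < S \<Longrightarrow> subalgebra (\<F> r (Suc s) 0) (\<F> r s m)"
    and \<F>_round: "\<And>r. Suc r < R \<Longrightarrow> subalgebra (\<F> (Suc r) 0 0) (\<F> r (S - 1) m)"
    and zhat_measurable: "\<And>r s k. r < R \<Longrightarrow> s < S \<Longrightarrow> k < m \<Longrightarrow>
      zhat r s k \<in> borel_measurable (\<F> r s k)"
    and idx_measurable: "\<And>r s k. r < R \<Longrightarrow> s < S \<Longrightarrow> k < m \<Longrightarrow>
      idx r s k \<in> \<F> r s (Suc k) \<rightarrow>\<^sub>M count_space {1..n}"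
    and pick_measurable: "\<And>r s. r < R \<Longrightarrow> s < S \<Longrightarrow> pick r s \<in> M \<rightarrow>\<^sub>M count_space {..<m}"
    and pick_measurable_epoch: "\<And>r s. r < R \<Longrightarrow> Suc s < S \<Longrightarrow>
      pick r s \<in> \<F> r (Suc s) 0 \<rightarrow>\<^sub>M count_space {..<m}"
    and pick_measurable_round: "\<And>r. Suc r < R \<Longrightarrow>
      pick r (S - 1) \<in> \<F> (Suc r) 0 0 \<rightarrow>\<^sub>M count_space {..<m}"
    and idx_uniform: "\<And>r s k. r < R \<Longrightarrow> s < S \<Longrightarrow> k < m \<Longrightarrow>
      distr M (count_space {1..n}) (idx r s k) = uniform_count_measure {1..n}"
    and idx_indep: "\<And>r s k. r < R \<Longrightarrow> s < S \<Longrightarrow> k < m \<Longrightarrow>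
      indep_set (sets (vimage_algebra (space M) (idx r s k) (count_space {1..n}))) (sets (\<F> r s k))"
    and pick_uniform: "\<And>r s. r < R \<Longrightarrow> s < S \<Longrightarrow>
      distr M (count_space {..<m}) (pick r s) = uniform_count_measure {..<m}"
    and pick_indep: "\<And>r s. r < R \<Longrightarrow> s < S \<Longrightarrow>
      indep_set (sets (vimage_algebra (space M) (pick r s) (count_space {..<m}))) (sets (\<F> r s m))"

text \<open>
  Here \<open>c\<^sub>1 n \<le> m \<le> c\<^sub>2 n\<close>, and \<open>C\<close> is the constant in the bound on the overlap estimate. The
  constants are given explicitly because a constant obtained from an existential quantifier inside
  a theorem could depend on the dimension, which is a type parameter.
\<close>

definition epochs_const :: "real \<Rightarrow> real \<Rightarrow> real \<Rightarrow> real" where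
  "epochs_const \<omega> c\<^sub>1 C = 1 + 2 * \<omega> * sqrt ((1 + 2 * C) / c\<^sub>1)"

definition rounds_const :: "real \<Rightarrow> real" where
  "rounds_const \<omega> = 1 + 1 / ln \<omega>"

definition oracle_const :: "real \<Rightarrow> real \<Rightarrow> real \<Rightarrow> real \<Rightarrow> real" where
  "oracle_const \<omega> c\<^sub>1 c\<^sub>2 C = rounds_const \<omega> * epochs_const \<omega> c\<^sub>1 C * (1 + 2 * c\<^sub>2)"

end

theory Submission
  imports Defs
begin

text \<open>
  Along the virtual iterates, \<open>\<parallel>z\<^sub>k - u\<parallel>\<^sup>2\<close> decreases as in SVRG, except that the gradient is evaluated at a
  stale point. The resulting inner products \<open>\<langle>J G\<^sub>j, G\<^sub>k\<rangle>\<close> of two sparse stochastic gradients are bounded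
  by \<open>sqrt \<Delta> / 2\<close> times the sum of the second moments, so an epoch behaves like a synchronous one
  whose variance is inflated by \<open>b = 1 + 2 sqrt \<Delta> \<tau>t\<close>. Cocoercivity bounds the variance by
  \<open>2 L (f x - f y + \<langle>\<nabla>f y, y - x\<rangle>) + 2 \<langle>\<nabla>f y, D \<nabla>f x\<rangle>\<close>, and \<open>\<theta>\<close>, \<open>\<phi>\<close>, \<open>\<eta>\<close> are chosen such that both inner
  products cancel against the linear term. With \<open>q = (1 - \<theta>) / \<theta> = sqrt (\<kappa> b / m)\<close> the epochs telescope
  over a round, and quadratic growth yields the contraction factor \<open>2 q / S \<le> 1 / \<omega>\<close>.
\<close>

section \<open>Smooth convex functions\<close>

text \<open>The delay matrices may depend on the outcome in any way, so no average over a sample is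
  taken while they are present. They are removed pointwise, by passing to absolute values of single
  coordinates. After that, every \<open>G j\<close> with \<open>j < k\<close> is known before
  \<open>idx k\<close> is drawn, and this sample touches a given coordinate with probability at most
  \<open>\<Delta>\<close>. The bound for step \<open>k\<close> still contains second moments of
  earlier steps, so the inflation factor appears only after summation over an epoch, where each
  second moment receives weight at most \<open>2 * \<tau>\<close>. The value of
  \<open>\<theta>\<close> balances two costs of a round: the initial function gap carries the factor
  \<open>q\<close>, and quadratic growth turns the initial distance into the factor
  \<open>1 / (\<eta> * m * \<mu>)\<close>. Both are equal for
  \<open>q * q = \<kappa> * b / m\<close>, whence the 2 in the contraction factor. A second obstacle
  is integrability. A Bochner integral of a non-integrable function is 0 by convention, so every
  iterate must be square-integrable, and the independence of a sample is usable only for iterates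
  measurable with respect to the information before it. Both properties are carried along the run by
  induction.\<close>

lemma gradient_eqI:
  assumes "GDERIV g x :> D"
  shows "gradient g x = D"
  unfolding gradient_def
proof (rule the_equality[where P = "\<lambda>D. GDERIV g x :> D", OF assms])
  fix E assume "GDERIV g x :> E"
  then have "(\<lambda>h. h \<bullet> E) = (\<lambda>h. h \<bullet> D)"
    using assms by (simp add: gderiv_def has_derivative_unique)
  then have "(E - D) \<bullet> E = (E - D) \<bullet> D" by metis
  then have "(E - D) \<bullet> (E - D) = 0" by (simp add: inner_diff_right)
  then show "E = D" by simp
qed

lemma L_smooth_gderiv:
  assumes "L_smooth L g"
  shows "GDERIV g x :> gradient g x"
  using assms gradient_eqI unfolding L_smooth_def by metis

lemma L_smooth_gradient_lipschitz:
  assumes "L_smooth L g"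
  shows "norm (gradient g x - gradient g y) \<le> L * norm (x - y)"
  using assms unfolding L_smooth_def by blast

lemma gderiv_along_line:
  assumes "GDERIV g (x + t *\<^sub>R d) :> D"
  shows "((\<lambda>t. g (x + t *\<^sub>R d)) has_real_derivative (d \<bullet> D)) (at t)"
proof -
  have "((\<lambda>t. x + t *\<^sub>R d) has_derivative (\<lambda>h. h *\<^sub>R d)) (at t)"
    by (auto intro!: derivative_eq_intros)
  then have "((\<lambda>t. g (x + t *\<^sub>R d)) has_derivative (\<lambda>h. (h *\<^sub>R d) \<bullet> D)) (at t)"
    using assms unfolding gderiv_def by (rule has_derivative_compose)
  then show ?thesis
    by (simp add: has_field_derivative_def mult.commute[of _ "d \<bullet> D"])
qed

text \<open>Along the segment, \<open>g\<close> minus its quadratic model has nonpositive derivative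
  for \<open>t \<ge> 0\<close>, by Cauchy-Schwarz and the Lipschitz bound. Monotonicity thus
  replaces integration of the gradient.\<close>

lemma L_smooth_upper_bound:
  assumes "L_smooth L g"
  shows "g y \<le> g x + gradient g x \<bullet> (y - x) + L / 2 * (norm (y - x))\<^sup>2"
proof -
  define d where "d = y - x"
  define h where "h t = g (x + t *\<^sub>R d) - t * (gradient g x \<bullet> d) - L / 2 * (norm d)\<^sup>2 * t\<^sup>2" for t
  have "h 1 \<le> h 0"
  proof (rule DERIV_nonpos_imp_nonincreasing[where f = h and a = 0 and b = 1])
    fix t :: real assume t: "0 \<le> t"
    let ?D = "d \<bullet> gradient g (x + t *\<^sub>R d) - gradient g x \<bullet> d - L * (norm d)\<^sup>2 * t"
    have "(h has_real_derivative ?D) (at t)"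
      unfolding h_def
      by (auto intro!: derivative_eq_intros gderiv_along_line L_smooth_gderiv[OF assms])
    moreover have "?D \<le> 0"
    proof -
      have "d \<bullet> gradient g (x + t *\<^sub>R d) - gradient g x \<bullet> d
          = (gradient g (x + t *\<^sub>R d) - gradient g x) \<bullet> d"
        by (simp add: inner_diff_left inner_commute[of d])
      also have "\<dots> \<le> norm (gradient g (x + t *\<^sub>R d) - gradient g x) * norm d"
        by (rule norm_cauchy_schwarz)
      also have "\<dots> \<le> (L * norm (t *\<^sub>R d)) * norm d"
        using L_smooth_gradient_lipschitz[OF assms, of "x + t *\<^sub>R d" x]
        by (intro mult_right_mono) auto
      also have "\<dots> = L * (norm d)\<^sup>2 * t"
        using t by (simp add: power2_eq_square)
      finally show ?thesis by simp
    qed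
    ultimately show "\<exists>D. (h has_real_derivative D) (at t) \<and> D \<le> 0" by blast
  qed simp
  then show ?thesis by (simp add: h_def d_def)
qed

text \<open>Restriction to the line through \<open>x\<close> and \<open>y\<close> reduces the claim
  to the tangent inequality for convex functions of one variable.\<close>

lemma convex_gradient_lower_bound:
  assumes "convex_on UNIV g" and "GDERIV g x :> D"
  shows "g y \<ge> g x + D \<bullet> (y - x)"
proof -
  define h where "h t = g (x + t *\<^sub>R (y - x))" for t
  have "convex_on UNIV h"
  proof (rule convex_onI)
    fix t a b :: real assume "0 < t" "t < 1"
    have "x + ((1 - t) *\<^sub>R a + t *\<^sub>R b) *\<^sub>R (y - x)
        = (1 - t) *\<^sub>R (x + a *\<^sub>R (y - x)) + t *\<^sub>R (x + b *\<^sub>R (y - x))"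
      by (simp add: algebra_simps)
    with \<open>0 < t\<close> \<open>t < 1\<close> show "h ((1 - t) *\<^sub>R a + t *\<^sub>R b) \<le> (1 - t) * h a + t * h b"
      unfolding h_def using convex_onD[OF assms(1), of t] by simp
  qed simp
  moreover have "(h has_real_derivative ((y - x) \<bullet> D)) (at 0)"
    unfolding h_def by (rule gderiv_along_line) (simp add: assms(2))
  ultimately have "h 1 - h 0 \<ge> ((y - x) \<bullet> D) * (1 - 0)"
    by (intro convex_on_imp_above_tangent[where A = UNIV]) auto
  then show ?thesis by (simp add: h_def inner_commute)
qed

text \<open>Compare \<open>g\<close> at the gradient step \<open>x - (\<nabla>g x - \<nabla>g y) / L\<close> from above, using smoothness at
  \<open>x\<close>, and from below, using convexity at \<open>y\<close>.\<close>

lemma L_smooth_convex_cocoercive: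
  assumes "L_smooth L g" and "convex_on UNIV g" and "L > 0"
  shows "(norm (gradient g y - gradient g x))\<^sup>2 \<le> 2 * L * (g x - g y - gradient g y \<bullet> (x - y))"
proof -
  define \<delta> where "\<delta> = gradient g x - gradient g y"
  define w where "w = x - (1 / L) *\<^sub>R \<delta>"
  have "g y + gradient g y \<bullet> (w - y) \<le> g w"
    by (rule convex_gradient_lower_bound[OF assms(2) L_smooth_gderiv[OF assms(1)]])
  also have "\<dots> \<le> g x + gradient g x \<bullet> (w - x) + L / 2 * (norm (w - x))\<^sup>2"
    by (rule L_smooth_upper_bound[OF assms(1)])
  \<comment> \<open>Exchanging the gradient at \<open>x\<close> for the one at \<open>y\<close>
    gains \<open>(1 / L) * (norm \<delta>)\<^sup>2\<close>; the quadratic term below takes back only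
    half of it.\<close>
  also have "gradient g x \<bullet> (w - x) = gradient g y \<bullet> (w - x) - (1 / L) * (norm \<delta>)\<^sup>2"
  proof -
    have "gradient g x \<bullet> (w - x) - gradient g y \<bullet> (w - x) = \<delta> \<bullet> (w - x)"
      by (simp add: \<delta>_def inner_diff_left)
    also have "\<dots> = - ((1 / L) * (norm \<delta>)\<^sup>2)"
      by (simp add: w_def power2_norm_eq_inner)
    finally show ?thesis by simp
  qed
  also have "L / 2 * (norm (w - x))\<^sup>2 = (1 / (2 * L)) * (norm \<delta>)\<^sup>2"
    using assms(3) by (simp add: w_def power_mult_distrib power2_eq_square field_simps)
  finally have "(1 / (2 * L)) * (norm \<delta>)\<^sup>2 \<le> g x - g y - gradient g y \<bullet> (x - y)"
    by (simp add: inner_diff_right field_simps)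
  then show ?thesis
    using assms(3) by (simp add: \<delta>_def norm_minus_commute field_simps)
qed

section \<open>Square-integrable random vectors\<close>

text \<open>On a probability space this class is closed under sums, bounded linear maps and
  Lipschitz maps, which are the operations of the algorithm, and inner products of two members are
  integrable. Measurability is a separate conjunct because integrability of the squared norm does
  not imply it.\<close>

definition sq_integrable :: "'w measure \<Rightarrow> ('w \<Rightarrow> 'b::euclidean_space) \<Rightarrow> bool" where
  "sq_integrable M X \<longleftrightarrow> X \<in> borel_measurable M \<and> integrable M (\<lambda>\<xi>. (norm (X \<xi>))\<^sup>2)"

lemma sq_integrable_measurable: "sq_integrable M X \<Longrightarrow> X \<in> borel_measurable M"
  by (simp add: sq_integrable_def)

lemma sq_integrable_cong:
  assumes "\<And>\<xi>. \<xi> \<in> space M \<Longrightarrow> X \<xi> = Y \<xi>"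
  shows "sq_integrable M X \<longleftrightarrow> sq_integrable M Y"
  using assms unfolding sq_integrable_def
  by (intro conj_cong measurable_cong Bochner_Integration.integrable_cong) auto

lemma sq_integrable_dominated:
  fixes X :: "'w \<Rightarrow> 'b::euclidean_space" and Y :: "'w \<Rightarrow> 'c::euclidean_space"
  assumes "sq_integrable M Y" "X \<in> borel_measurable M"
    and "\<And>\<xi>. \<xi> \<in> space M \<Longrightarrow> norm (X \<xi>) \<le> norm (Y \<xi>)"
  shows "sq_integrable M X"
proof -
  have "integrable M (\<lambda>\<xi>. (norm (X \<xi>))\<^sup>2)"
  proof (rule Bochner_Integration.integrable_bound)
    show "integrable M (\<lambda>\<xi>. (norm (Y \<xi>))\<^sup>2)"
      using assms(1) by (simp add: sq_integrable_def)
    show "AE \<xi> in M. norm ((norm (X \<xi>))\<^sup>2) \<le> norm ((norm (Y \<xi>))\<^sup>2)"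
      using assms(3) by (intro AE_I2) (simp add: power_mono)
  qed (use assms(2) in measurable)
  with assms(2) show ?thesis by (simp add: sq_integrable_def)
qed

lemma sq_integrable_norm: "sq_integrable M X \<Longrightarrow> sq_integrable M (\<lambda>\<xi>. norm (X \<xi>))"
  unfolding sq_integrable_def by (auto intro: borel_measurable_norm)

lemma sq_integrable_scaleR: "sq_integrable M X \<Longrightarrow> sq_integrable M (\<lambda>\<xi>. c *\<^sub>R X \<xi>)"
  unfolding sq_integrable_def by (auto simp: power_mult_distrib intro: borel_measurable_scaleR)

lemma sq_integrable_add:
  fixes X Y :: "'w \<Rightarrow> 'b::euclidean_space"
  assumes X: "sq_integrable M X" and Y: "sq_integrable M Y"
  shows "sq_integrable M (\<lambda>\<xi>. X \<xi> + Y \<xi>)"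
proof -
  have [measurable]: "X \<in> borel_measurable M" "Y \<in> borel_measurable M"
    using assms by (simp_all add: sq_integrable_def)
  have "integrable M (\<lambda>\<xi>. (norm (X \<xi> + Y \<xi>))\<^sup>2)"
  proof (rule Bochner_Integration.integrable_bound)
    show "integrable M (\<lambda>\<xi>. 2 * (norm (X \<xi>))\<^sup>2 + 2 * (norm (Y \<xi>))\<^sup>2)"
      using assms by (simp add: sq_integrable_def)
    have "(norm (a + b))\<^sup>2 \<le> 2 * (norm a)\<^sup>2 + 2 * (norm b)\<^sup>2" for a b :: 'b
      using inner_ge_zero[of "a - b"]
      by (simp add: power2_norm_eq_inner inner_commute algebra_simps)
    then show "AE \<xi> in M. norm ((norm (X \<xi> + Y \<xi>))\<^sup>2) \<le> norm (2 * (norm (X \<xi>))\<^sup>2 + 2 * (norm (Y \<xi>))\<^sup>2)"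
      by (intro AE_I2) simp
  qed measurable
  then show ?thesis by (simp add: sq_integrable_def)
qed

lemma sq_integrable_diff:
  assumes "sq_integrable M X" and "sq_integrable M Y"
  shows "sq_integrable M (\<lambda>\<xi>. X \<xi> - Y \<xi>)"
  using sq_integrable_add[OF assms(1) sq_integrable_scaleR[OF assms(2), of "-1"]] by simp

lemma sq_integrable_sum:
  assumes "finite I" "\<And>i. i \<in> I \<Longrightarrow> sq_integrable M (X i)"
  shows "sq_integrable M (\<lambda>\<xi>. \<Sum>i\<in>I. X i \<xi>)"
  using assms
proof (induction I rule: finite_induct)
  case empty
  show ?case by (simp add: sq_integrable_def)
next
  case (insert i I)
  then show ?case by (simp add: sq_integrable_add)
qed

lemma integrable_inner_sq_integrable:
  fixes X Y :: "'w \<Rightarrow> 'b::euclidean_space"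
  assumes X: "sq_integrable M X" and Y: "sq_integrable M Y"
  shows "integrable M (\<lambda>\<xi>. X \<xi> \<bullet> Y \<xi>)"
proof -
  have "X \<xi> \<bullet> Y \<xi> = ((norm (X \<xi> + Y \<xi>))\<^sup>2 - (norm (X \<xi>))\<^sup>2 - (norm (Y \<xi>))\<^sup>2) / 2" for \<xi>
    by (simp add: power2_norm_eq_inner inner_add_left inner_add_right inner_commute)
  then have "(\<lambda>\<xi>. X \<xi> \<bullet> Y \<xi>)
      = (\<lambda>\<xi>. ((norm (X \<xi> + Y \<xi>))\<^sup>2 - (norm (X \<xi>))\<^sup>2 - (norm (Y \<xi>))\<^sup>2) / 2)"
    by (rule ext)
  moreover have "integrable M (\<lambda>\<xi>. ((norm (X \<xi> + Y \<xi>))\<^sup>2 - (norm (X \<xi>))\<^sup>2 - (norm (Y \<xi>))\<^sup>2) / 2)"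
    using assms sq_integrable_add[OF assms] by (simp add: sq_integrable_def)
  ultimately show ?thesis by simp
qed

context finite_measure
begin

lemma sq_integrable_const: "sq_integrable M (\<lambda>\<xi>. c)"
  by (simp add: sq_integrable_def)

lemma sq_integrable_bounded_linear:
  assumes "sq_integrable M X" "bounded_linear h"
  shows "sq_integrable M (\<lambda>\<xi>. h (X \<xi>))"
proof -
  obtain K where K: "K \<ge> 0" "\<And>x. norm (h x) \<le> norm x * K"
    using bounded_linear.nonneg_bounded[OF assms(2)] by blast
  have "h \<in> borel_measurable borel"
    using linear_continuous_on[OF assms(2)] by (rule borel_measurable_continuous_onI)
  then have "(\<lambda>\<xi>. h (X \<xi>)) \<in> borel_measurable M"
    using measurable_compose[OF sq_integrable_measurable[OF assms(1)]] by blast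
  then show ?thesis
    using K by (intro sq_integrable_dominated[OF sq_integrable_scaleR[OF assms(1), of K]])
      (auto simp: mult.commute)
qed

text \<open>A Lipschitz map grows at most linearly, and finite total mass makes the constant
  \<open>norm (h 0)\<close> square-integrable. Gradients of smooth functions are handled this
  way.\<close>

lemma sq_integrable_lipschitz:
  fixes h :: "'b::euclidean_space \<Rightarrow> 'c::euclidean_space"
  assumes X: "sq_integrable M X" and h: "C-lipschitz_on UNIV h"
  shows "sq_integrable M (\<lambda>\<xi>. h (X \<xi>))"
proof -
  have "h \<in> borel_measurable borel"
    using lipschitz_on_continuous_on[OF h] by (rule borel_measurable_continuous_onI)
  then have meas: "(\<lambda>\<xi>. h (X \<xi>)) \<in> borel_measurable M"
    using measurable_compose[OF sq_integrable_measurable[OF X]] by blast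
  have sq: "sq_integrable M (\<lambda>\<xi>. norm (h 0) + C *\<^sub>R norm (X \<xi>))"
    by (intro sq_integrable_add sq_integrable_const sq_integrable_scaleR sq_integrable_norm X)
  show ?thesis
  proof (rule sq_integrable_dominated[OF sq meas])
    fix \<xi>
    have "norm (h (X \<xi>)) \<le> norm (h 0) + norm (h (X \<xi>) - h 0)"
      using norm_triangle_ineq[of "h 0" "h (X \<xi>) - h 0"] by simp
    also have "norm (h (X \<xi>) - h 0) \<le> C * norm (X \<xi>)"
      using lipschitz_on_normD[OF h, of "X \<xi>" 0] by simp
    finally show "norm (h (X \<xi>)) \<le> norm (norm (h 0) + C *\<^sub>R norm (X \<xi>))" by simp
  qed
qed

lemma sq_integrable_integrable:
  assumes "sq_integrable M X"
  shows "integrable M (\<lambda>\<xi>. norm (X \<xi>))"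
  using assms by (rule_tac square_integrable_imp_integrable) (auto simp: sq_integrable_def intro: borel_measurable_norm)

lemma sq_integrable_nth:
  fixes X :: "'a \<Rightarrow> real ^ 'd"
  assumes "sq_integrable M X"
  shows "sq_integrable M (\<lambda>\<xi>. X \<xi> $ v)"
  by (rule sq_integrable_bounded_linear[OF assms bounded_linear_vec_nth])

lemma integrable_abs_nth_mult:
  fixes X Y :: "'a \<Rightarrow> real ^ 'd"
  assumes "sq_integrable M X" "sq_integrable M Y"
  shows "integrable M (\<lambda>\<xi>. \<bar>X \<xi> $ v\<bar> * \<bar>Y \<xi> $ v\<bar>)"
  using integrable_inner_sq_integrable[OF sq_integrable_norm[OF sq_integrable_nth[OF assms(1)]]
      sq_integrable_norm[OF sq_integrable_nth[OF assms(2)]]]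
  by simp

end

section \<open>Uniform random indices\<close>

text \<open>Conditioning on the independent \<open>\<sigma>\<close>-algebra \<open>A\<close> amounts to averaging over the values of
  the index.\<close>

lemma (in prob_space) expectation_uniform_index:
  fixes h :: "'i \<Rightarrow> 'a \<Rightarrow> real"
  assumes "finite I" "I \<noteq> {}"
    and N: "N \<in> M \<rightarrow>\<^sub>M count_space I"
    and unif: "distr M (count_space I) N = uniform_count_measure I"
    and indep: "indep_set (sets (vimage_algebra (space M) N (count_space I))) (sets A)"
    and A: "subalgebra M A"
    and h_meas: "\<And>i. i \<in> I \<Longrightarrow> h i \<in> borel_measurable A"
    and h_int: "\<And>i. i \<in> I \<Longrightarrow> integrable M (h i)"
  shows "integrable M (\<lambda>\<xi>. h (N \<xi>) \<xi>)"
    and "expectation (\<lambda>\<xi>. h (N \<xi>) \<xi>) = (1 / real (card I)) * (\<Sum>i\<in>I. expectation (h i))"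
proof -
  define E where "E i = N -` {i} \<inter> space M" for i
  define X where "X i = (indicator (E i) :: 'a \<Rightarrow> real)" for i
  have E: "E i \<in> sets M" if "i \<in> I" for i
    unfolding E_def by (rule measurable_sets[OF N]) (use that in simp)
  have E_vimage: "E i \<in> sets (vimage_algebra (space M) N (count_space I))" if "i \<in> I" for i
    unfolding E_def by (rule in_vimage_algebra) (use that in simp)
  have prob_E: "prob (E i) = 1 / real (card I)" if "i \<in> I" for i
  proof -
    have "prob (E i) = measure (distr M (count_space I) N) {i}"
      unfolding E_def using N that by (subst measure_distr) auto
    then show ?thesis
      using that \<open>finite I\<close> by (simp add: unif measure_uniform_count_measure)
  qed
  have space_A: "space A = space M" and sets_A: "sets A \<subseteq> sets M"
    using A by (auto simp: subalgebra_def)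
  \<comment> \<open>Independence passes to the smaller \<open>\<sigma>\<close>-algebras generated by
    the indicator \<open>X i\<close> and by \<open>h i\<close>, so the expectation of their product
    factors. Exactly one indicator is nonzero at each outcome, which gives \<open>decomp\<close>
    below.\<close>
  have indep_X: "indep_var borel (X i) borel (h i)" if i: "i \<in> I" for i
    unfolding indep_var_eq
  proof (intro conjI)
    show "random_variable borel (X i)" using E[OF i] by (simp add: X_def)
    show "random_variable borel (h i)"
      using measurable_from_subalg[OF A h_meas[OF i]] .
    have "X i \<in> borel_measurable (vimage_algebra (space M) N (count_space I))"
      unfolding X_def using E_vimage[OF i] by (rule borel_measurable_indicator)
    then have "{X i -` B \<inter> space M | B. B \<in> sets borel} \<subseteq> sets (vimage_algebra (space M) N (count_space I))"
      using measurable_sets[where M = "vimage_algebra (space M) N (count_space I)" and f = "X i"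
        and A = borel]
      by auto
    then have *: "sigma_sets (space M) {X i -` B \<inter> space M | B. B \<in> sets borel}
        \<subseteq> sets (vimage_algebra (space M) N (count_space I))"
      using sets.sigma_sets_subset[of "{X i -` B \<inter> space M | B. B \<in> sets borel}"
          "vimage_algebra (space M) N (count_space I)"]
      unfolding space_vimage_algebra by iprover
    have "{h i -` B \<inter> space M | B. B \<in> sets borel} \<subseteq> sets A"
      using measurable_sets[OF h_meas[OF i]] unfolding space_A by auto
    then have "sigma_sets (space M) {h i -` B \<inter> space M | B. B \<in> sets borel} \<subseteq> sets A"
      unfolding space_A[symmetric] by (rule sets.sigma_sets_subset)
    with * show "indep_set (sigma_sets (space M) {X i -` B \<inter> space M | B. B \<in> sets borel})
        (sigma_sets (space M) {h i -` B \<inter> space M | B. B \<in> sets borel})"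
      unfolding indep_set_def
      by (intro indep_sets_mono_sets[OF indep[unfolded indep_set_def]]) (simp split: bool.split)
  qed
  have X_int: "integrable M (X i)" if "i \<in> I" for i
    unfolding X_def using E[OF that] by (simp add: integrable_indicator_iff emeasure_eq_measure)
  have decomp: "h (N \<xi>) \<xi> = (\<Sum>i\<in>I. X i \<xi> * h i \<xi>)" if "\<xi> \<in> space M" for \<xi>
  proof -
    have "N \<xi> \<in> I" using measurable_space[OF N that] by simp
    have "(\<Sum>i\<in>I. X i \<xi> * h i \<xi>) = (\<Sum>i\<in>I. if i = N \<xi> then h i \<xi> else 0)"
      using that by (intro sum.cong) (auto simp: X_def E_def)
    then show ?thesis using \<open>finite I\<close> \<open>N \<xi> \<in> I\<close> by simp
  qed
  have int: "integrable M (\<lambda>\<xi>. X i \<xi> * h i \<xi>)" if "i \<in> I" for i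
    by (rule indep_var_integrable[OF indep_X X_int h_int]) (use that in auto)
  show "integrable M (\<lambda>\<xi>. h (N \<xi>) \<xi>)"
    using int by (subst Bochner_Integration.integrable_cong[OF refl decomp]) auto
  have "expectation (\<lambda>\<xi>. h (N \<xi>) \<xi>) = (\<Sum>i\<in>I. expectation (\<lambda>\<xi>. X i \<xi> * h i \<xi>))"
    using int by (subst Bochner_Integration.integral_cong[OF refl decomp]) auto
  also have "\<dots> = (\<Sum>i\<in>I. prob (E i) * expectation (h i))"
    using E by (intro sum.cong refl, subst indep_var_lebesgue_integral[OF indep_X X_int h_int])
      (auto simp: X_def)
  also have "\<dots> = (1 / real (card I)) * (\<Sum>i\<in>I. expectation (h i))"
    by (simp add: prob_E sum_distrib_left)
  finally show "expectation (\<lambda>\<xi>. h (N \<xi>) \<xi>) = (1 / real (card I)) * (\<Sum>i\<in>I. expectation (h i))" .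
qed

section \<open>Averages of sparse functions\<close>

lemma gderiv_sum:
  assumes "finite I" and "\<And>i. i \<in> I \<Longrightarrow> GDERIV (f i) x :> D i"
  shows "GDERIV (\<lambda>x. \<Sum>i\<in>I. f i x) x :> (\<Sum>i\<in>I. D i)"
  using assms unfolding gderiv_def by (simp add: inner_sum_right has_derivative_sum)

lemma gderiv_cmult:
  assumes "GDERIV g x :> D"
  shows "GDERIV (\<lambda>x. c * g x) x :> c *\<^sub>R D"
  using GDERIV_mult[OF GDERIV_const[of c] assms] by simp

text \<open>Moving along the axis of a coordinate outside \<open>A\<close> leaves \<open>g\<close>
  constant, so the derivative in that direction vanishes.\<close>

lemma supported_on_gradient_eq_0:
  assumes "supported_on A g" and "GDERIV g x :> D" and "v \<notin> A"
  shows "D $ v = 0"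
proof -
  have "g (x + t *\<^sub>R axis v 1) = g x" for t
  proof -
    have "\<forall>w\<in>A. (x + t *\<^sub>R axis v 1) $ w = x $ w"
      using assms(3) by (auto simp: axis_def)
    then show ?thesis
      using assms(1) unfolding supported_on_def by blast
  qed
  moreover have "((\<lambda>t. g (x + t *\<^sub>R axis v 1)) has_real_derivative (axis v 1 \<bullet> D)) (at 0)"
    by (rule gderiv_along_line) (simp add: assms(2))
  ultimately have "axis v 1 \<bullet> D = 0"
    using DERIV_unique[OF _ DERIV_const] by fastforce
  then show ?thesis by (simp add: inner_commute inner_axis)
qed

lemma matrix_inv_eqI:
  fixes A :: "real ^ 'd ^ 'd"
  assumes "A ** B = mat 1" and "B ** A = mat 1"
  shows "matrix_inv A = B"
proof -
  have "A ** matrix_inv A = mat 1 \<and> matrix_inv A ** A = mat 1"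
    unfolding matrix_inv_def using assms by (rule_tac someI[where x = B]) simp
  then have "B = B ** (A ** matrix_inv A)" by simp
  also have "\<dots> = matrix_inv A"
    using assms(2) by (simp only: matrix_mul_assoc matrix_mul_lid)
  finally show ?thesis ..
qed

text \<open>The probability that a uniformly drawn index touches \<open>v\<close>. It is also the
  diagonal entry at \<open>v\<close> of the averaged projection matrix, so its reciprocal is the
  entry of \<open>reweight n T\<close>.\<close>

definition overlap :: "nat \<Rightarrow> (nat \<Rightarrow> 'd set) \<Rightarrow> 'd \<Rightarrow> real" where
  "overlap n T v = real (card {i \<in> {1..n}. v \<in> T i}) / real n"

lemma coord_proj_mult_vec_nth:
  "(coord_proj A *v x) $ v = (if v \<in> A then x $ v else 0)"
proof -
  have "(coord_proj A *v x) $ v = (\<Sum>w\<in>UNIV. if v = w then (if v \<in> A then x $ v else 0) else 0)"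
    unfolding coord_proj_def matrix_vector_mult_def
    by (simp only: vec_lambda_beta, intro sum.cong) auto
  then show ?thesis by simp
qed

lemma overlap_le_max_overlap: "overlap n T v \<le> max_overlap n T"
  unfolding overlap_def max_overlap_def by (simp add: divide_right_mono)

lemma reweight_mult_vec_nth:
  fixes T :: "nat \<Rightarrow> 'd::finite set"
  assumes "\<And>v. overlap n T v \<noteq> 0"
  shows "(reweight n T *v x) $ v = x $ v / overlap n T v"
proof -
  define B :: "real ^ 'd ^ 'd" where "B = (\<chi> v w. if v = w then 1 / overlap n T v else 0)"
  let ?A = "(1 / real n) *\<^sub>R (\<Sum>i=1..n. coord_proj (T i)) :: real ^ 'd ^ 'd"
  have A: "?A = (\<chi> v w. if v = w then overlap n T v else 0)"
    by (auto simp: vec_eq_iff coord_proj_def overlap_def sum.If_cases Int_def)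
  have "?A ** B = mat 1" "B ** ?A = mat 1"
    unfolding A B_def using assms
    by (auto simp: vec_eq_iff matrix_matrix_mult_def mat_def if_distrib[of "\<lambda>x. x * _"] cong: if_cong)
  then have "reweight n T = B"
    unfolding reweight_def by (rule matrix_inv_eqI)
  then show ?thesis
    by (simp add: B_def matrix_vector_mult_def if_distrib[of "\<lambda>x. x * _"] cong: if_cong)
qed

locale sparse_convex_sum =
  fixes f :: "nat \<Rightarrow> real ^ 'd::finite \<Rightarrow> real"
    and n :: nat
    and T :: "nat \<Rightarrow> 'd set"
    and L :: real
  assumes cover: "\<And>v. \<exists>i\<in>{1..n}. v \<in> T i"
    and convex: "\<And>i. i \<in> {1..n} \<Longrightarrow> convex_on UNIV (f i)"
    and smooth: "\<And>i. i \<in> {1..n} \<Longrightarrow> L_smooth L (f i)"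
    and supp: "\<And>i. i \<in> {1..n} \<Longrightarrow> supported_on (T i) (f i)"
    and L_pos: "L > 0"
begin

abbreviation F :: "real ^ 'd \<Rightarrow> real" where "F \<equiv> mean_fun n f"

text \<open>Follows from \<open>cover\<close>, because the coordinate type is nonempty.\<close>

lemma n_pos: "n > 0"
  using cover by (metis atLeastAtMost_iff le_trans less_one linorder_not_less)

lemma overlap_pos: "overlap n T v > 0"
proof -
  have "{i \<in> {1..n}. v \<in> T i} \<noteq> {}" using cover[of v] by blast
  then have "card {i \<in> {1..n}. v \<in> T i} > 0" by (simp add: card_gt_0_iff)
  then show ?thesis using n_pos by (simp add: overlap_def)
qed

lemma max_overlap_pos: "max_overlap n T > 0"
  using overlap_pos overlap_le_max_overlap less_le_trans by blast

lemma reweight_nth: "(reweight n T *v x) $ v = x $ v / overlap n T v"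
  by (rule reweight_mult_vec_nth) (use overlap_pos less_irrefl in metis)

lemma coord_proj_reweight_nth:
  "((coord_proj (T i) ** reweight n T) *v x) $ v = (if v \<in> T i then x $ v / overlap n T v else 0)"
  by (simp add: matrix_vector_mul_assoc[symmetric] coord_proj_mult_vec_nth reweight_nth)

lemma gderiv_mean: "GDERIV F x :> (1 / real n) *\<^sub>R (\<Sum>i=1..n. gradient (f i) x)"
  unfolding mean_fun_def[abs_def]
  by (intro gderiv_cmult gderiv_sum L_smooth_gderiv[OF smooth]) auto

lemma gradient_mean: "gradient F x = (1 / real n) *\<^sub>R (\<Sum>i=1..n. gradient (f i) x)"
  by (rule gradient_eqI[OF gderiv_mean])

lemma L_smooth_mean: "L_smooth L F"
proof -
  have "norm (gradient F x - gradient F y) \<le> L * norm (x - y)" for x y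
  proof -
    have "norm (\<Sum>i=1..n. gradient (f i) x - gradient (f i) y) \<le> (\<Sum>i=1..n. L * norm (x - y))"
      by (intro order_trans[OF norm_sum] sum_mono L_smooth_gradient_lipschitz smooth) auto
    then have "(1 / real n) * norm (\<Sum>i=1..n. gradient (f i) x - gradient (f i) y)
        \<le> (1 / real n) * (\<Sum>i=1..n. L * norm (x - y))"
      by (intro mult_left_mono) auto
    then show ?thesis
      using n_pos by (simp add: gradient_mean scaleR_diff_right[symmetric] sum_subtractf)
  qed
  then show ?thesis
    unfolding L_smooth_def using gderiv_mean by blast
qed

lemma convex_mean: "convex_on UNIV F"
proof -
  have "convex_on UNIV (\<lambda>x. \<Sum>i\<in>I. f i x)" if "finite I" "I \<subseteq> {1..n}" for I
    using that
  proof (induction I rule: finite_induct)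
    case empty
    show ?case by (simp add: convex_on_const)
  next
    case (insert i I)
    then have "convex_on UNIV (f i)" "convex_on UNIV (\<lambda>x. \<Sum>i\<in>I. f i x)"
      using convex by auto
    then show ?case
      using insert.hyps by (simp add: convex_on_add)
  qed
  then show ?thesis
    unfolding mean_fun_def[abs_def] by (intro convex_on_cmul) auto
qed

lemma F_lower_bound: "F y \<ge> F x + gradient F x \<bullet> (y - x)"
  by (rule convex_gradient_lower_bound[OF convex_mean L_smooth_gderiv[OF L_smooth_mean]])

text \<open>The variance-reduced gradient as a deterministic function of the sampled index, the
  point and the snapshot. Separating it from the random index allows averaging over \<open>i\<close>
  with the points held fixed.\<close>

definition est :: "nat \<Rightarrow> real ^ 'd \<Rightarrow> real ^ 'd \<Rightarrow> real ^ 'd" where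
  "est i y w = gradient (f i) y - gradient (f i) w
     + (coord_proj (T i) ** reweight n T) *v gradient F w"

lemma gradient_nth_eq_0:
  assumes "i \<in> {1..n}" "v \<notin> T i"
  shows "gradient (f i) x $ v = 0"
  using supported_on_gradient_eq_0[OF supp L_smooth_gderiv[OF smooth]] assms by blast

lemma est_nth_eq_0:
  assumes "i \<in> {1..n}" "v \<notin> T i"
  shows "est i y w $ v = 0"
  using assms by (simp add: est_def gradient_nth_eq_0 coord_proj_reweight_nth)

text \<open>A coordinate survives in the fraction \<open>overlap n T v\<close> of the summands and
  is divided by that same number. This is the purpose of the reweighting: the sparse correction
  stays unbiased.\<close>

lemma mean_coord_proj_reweight:
  "(1 / real n) *\<^sub>R (\<Sum>i=1..n. (coord_proj (T i) ** reweight n T) *v x) = x"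
proof -
  have "(1 / real n) * (\<Sum>i=1..n. if v \<in> T i then x $ v / overlap n T v else 0) = x $ v" for v
  proof -
    have "(\<Sum>i=1..n. if v \<in> T i then x $ v / overlap n T v else 0)
        = real (card {i \<in> {1..n}. v \<in> T i}) * (x $ v / overlap n T v)"
      by (subst sum.inter_filter[symmetric]) auto
    also have "\<dots> = real n * overlap n T v * (x $ v / overlap n T v)"
      using n_pos by (simp add: overlap_def)
    finally show ?thesis using n_pos overlap_pos[of v] by simp
  qed
  then show ?thesis by (simp add: vec_eq_iff coord_proj_reweight_nth)
qed

lemma mean_est: "(1 / real n) *\<^sub>R (\<Sum>i=1..n. est i y w) = gradient F y"
proof -
  have "(1 / real n) *\<^sub>R (\<Sum>i=1..n. est i y w) = gradient F y - gradient F w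
      + (1 / real n) *\<^sub>R (\<Sum>i=1..n. (coord_proj (T i) ** reweight n T) *v gradient F w)"
    by (simp add: est_def gradient_mean sum.distrib sum_subtractf scaleR_add_right scaleR_diff_right)
  then show ?thesis by (simp add: mean_coord_proj_reweight del: One_nat_def)
qed

lemma inner_reweight_nonneg: "x \<bullet> (reweight n T *v x) \<ge> 0"
  unfolding inner_vec_def
  by (auto intro!: sum_nonneg divide_nonneg_pos simp: reweight_nth overlap_pos)

text \<open>The gradient difference \<open>g i\<close> and the correction \<open>p i\<close> live on
  \<open>T i\<close>, where \<open>p i\<close> agrees with \<open>d\<close>; hence one factor
  \<open>p i\<close> in each inner product may be replaced by the \<open>i\<close>-independent
  \<open>d\<close>. Cocoercivity bounds the square of \<open>g i\<close>. Averaging leaves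
  \<open>2 * (gradient F y \<bullet> d) - gradient F w \<bullet> d\<close>, whose second part is
  dropped by positivity of the reweighting.\<close>

lemma mean_norm_est_le:
  "(1 / real n) * (\<Sum>i=1..n. (norm (est i y w))\<^sup>2)
     \<le> 2 * L * (F w - F y - gradient F y \<bullet> (w - y)) + 2 * (gradient F y \<bullet> (reweight n T *v gradient F w))"
proof -
  define d where "d = reweight n T *v gradient F w"
  define p where "p i = (coord_proj (T i) ** reweight n T) *v gradient F w" for i
  define g where "g i = gradient (f i) y - gradient (f i) w" for i
  have gp: "g i \<bullet> p i = g i \<bullet> d" if "i \<in> {1..n}" for i
    unfolding inner_vec_def g_def p_def d_def using gradient_nth_eq_0[OF that]
    by (intro sum.cong) (auto simp: coord_proj_reweight_nth reweight_nth)
  have pp: "p i \<bullet> p i = p i \<bullet> d" for i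
    unfolding inner_vec_def p_def d_def
    by (intro sum.cong) (auto simp: coord_proj_reweight_nth reweight_nth)
  have "(norm (est i y w))\<^sup>2 \<le> 2 * L * (f i w - f i y - gradient (f i) y \<bullet> (w - y))
      + 2 * (g i \<bullet> d) + p i \<bullet> d" if i: "i \<in> {1..n}" for i
  proof -
    have "(norm (est i y w))\<^sup>2 = (norm (g i))\<^sup>2 + 2 * (g i \<bullet> p i) + p i \<bullet> p i"
      by (simp add: est_def g_def p_def power2_norm_eq_inner inner_add_left inner_add_right inner_commute)
    moreover have "(norm (g i))\<^sup>2 \<le> 2 * L * (f i w - f i y - gradient (f i) y \<bullet> (w - y))"
      unfolding g_def by (rule L_smooth_convex_cocoercive[OF smooth[OF i] convex[OF i] L_pos])
    ultimately show ?thesis using gp[OF i] pp by simp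
  qed
  then have "(1 / real n) * (\<Sum>i=1..n. (norm (est i y w))\<^sup>2) \<le> (1 / real n) *
      (\<Sum>i=1..n. 2 * L * (f i w - f i y - gradient (f i) y \<bullet> (w - y)) + 2 * (g i \<bullet> d) + p i \<bullet> d)"
    by (intro mult_left_mono sum_mono) auto
  also have "\<dots> = 2 * L * (F w - F y - gradient F y \<bullet> (w - y))
      + 2 * (((1 / real n) *\<^sub>R (\<Sum>i=1..n. g i)) \<bullet> d) + ((1 / real n) *\<^sub>R (\<Sum>i=1..n. p i)) \<bullet> d"
    by (simp add: mean_fun_def gradient_mean sum.distrib sum_subtractf inner_sum_left
        sum_distrib_left[symmetric] algebra_simps diff_divide_distrib add_divide_distrib)
  also have "(1 / real n) *\<^sub>R (\<Sum>i=1..n. g i) = gradient F y - gradient F w"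
    by (simp add: g_def gradient_mean sum_subtractf scaleR_diff_right)
  also have "(1 / real n) *\<^sub>R (\<Sum>i=1..n. p i) = gradient F w"
    unfolding p_def by (rule mean_coord_proj_reweight)
  finally show ?thesis
    using inner_reweight_nonneg[of "gradient F w"] by (simp add: d_def inner_diff_left)
qed

text \<open>Only the fraction \<open>overlap n T v\<close> of the vectors \<open>h i\<close> has a nonzero coordinate \<open>v\<close>;
  weighting Young's inequality by \<open>sqrt \<Delta>\<close> turns this sparsity into a small factor.\<close>

lemma mean_sparse_product_le:
  assumes "\<And>i v. i \<in> {1..n} \<Longrightarrow> v \<notin> T i \<Longrightarrow> h i $ v = 0"
  shows "(1 / real n) * (\<Sum>i=1..n. \<Sum>v\<in>UNIV. \<bar>a $ v\<bar> * \<bar>h i $ v\<bar>)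
    \<le> sqrt (max_overlap n T) / 2 * ((norm a)\<^sup>2 + (1 / real n) * (\<Sum>i=1..n. (norm (h i))\<^sup>2))"
proof -
  define \<Delta> where "\<Delta> = max_overlap n T"
  have \<Delta>: "\<Delta> > 0" by (simp add: \<Delta>_def max_overlap_pos)
  have norm2: "(norm x)\<^sup>2 = (\<Sum>v\<in>UNIV. (x $ v)\<^sup>2)" for x :: "real ^ 'd"
    unfolding power2_norm_eq_inner inner_vec_def by (simp add: power2_eq_square)
  have young: "s * t \<le> sqrt \<Delta> / 2 * (s\<^sup>2 / \<Delta> + t\<^sup>2)" for s t :: real
  proof -
    have "0 \<le> (s / sqrt \<Delta> - t)\<^sup>2" by simp
    also have "\<dots> = s\<^sup>2 / \<Delta> + t\<^sup>2 - 2 * (s * t) / sqrt \<Delta>"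
      using \<Delta> by (simp add: power2_diff power_divide)
    finally have "2 * (s * t) / sqrt \<Delta> \<le> s\<^sup>2 / \<Delta> + t\<^sup>2" by simp
    then show ?thesis using \<Delta> by (simp add: field_simps)
  qed
  \<comment> \<open>Sparsity enters here: for \<open>v\<close> outside \<open>T i\<close> the
    product is zero, so the term with \<open>a $ v\<close> is charged only for the indices that
    touch \<open>v\<close>.\<close>
  have term_le: "\<bar>a $ v\<bar> * \<bar>h i $ v\<bar>
      \<le> sqrt \<Delta> / 2 * ((if v \<in> T i then (a $ v)\<^sup>2 / \<Delta> else 0) + (h i $ v)\<^sup>2)"
    if "i \<in> {1..n}" for i v
    using young[of "\<bar>a $ v\<bar>" "\<bar>h i $ v\<bar>"] assms[OF that, of v] by auto
  have "(1 / real n) * (\<Sum>i=1..n. \<Sum>v\<in>UNIV. \<bar>a $ v\<bar> * \<bar>h i $ v\<bar>) \<le> (1 / real n) *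
      (\<Sum>i=1..n. \<Sum>v\<in>UNIV. sqrt \<Delta> / 2 * ((if v \<in> T i then (a $ v)\<^sup>2 / \<Delta> else 0) + (h i $ v)\<^sup>2))"
    by (intro mult_left_mono sum_mono term_le) auto
  also have "\<dots> = sqrt \<Delta> / 2 * ((1 / real n) * (\<Sum>i=1..n. \<Sum>v\<in>UNIV. if v \<in> T i then (a $ v)\<^sup>2 / \<Delta> else 0)
      + (1 / real n) * (\<Sum>i=1..n. (norm (h i))\<^sup>2))"
    by (simp only: norm2 sum.distrib sum_distrib_left[symmetric] distrib_left) (simp add: algebra_simps)
  also have "(1 / real n) * (\<Sum>i=1..n. \<Sum>v\<in>UNIV. if v \<in> T i then (a $ v)\<^sup>2 / \<Delta> else 0)
      = (\<Sum>v\<in>UNIV. overlap n T v * ((a $ v)\<^sup>2 / \<Delta>))"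
  proof -
    have "(\<Sum>i=1..n. if v \<in> T i then (a $ v)\<^sup>2 / \<Delta> else 0)
        = real n * (overlap n T v * ((a $ v)\<^sup>2 / \<Delta>))" for v
      using n_pos by (subst sum.inter_filter[symmetric]) (auto simp: overlap_def)
    then show ?thesis
      using n_pos by (subst sum.swap) (simp only: sum_distrib_left[symmetric], simp)
  qed
  also have "\<dots> \<le> (norm a)\<^sup>2"
    unfolding norm2
  proof (rule sum_mono)
    fix v
    have "overlap n T v * (a $ v)\<^sup>2 \<le> \<Delta> * (a $ v)\<^sup>2"
      by (intro mult_right_mono) (auto simp: \<Delta>_def overlap_le_max_overlap)
    then show "overlap n T v * ((a $ v)\<^sup>2 / \<Delta>) \<le> (a $ v)\<^sup>2"
      using \<Delta> by (simp add: field_simps)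
  qed
  finally show ?thesis
    using \<Delta> by (simp add: \<Delta>_def mult_left_mono)
qed

text \<open>The parameters are chosen such that all terms containing \<open>gradient F y\<close> cancel, except for the
  one that convexity bounds.\<close>

lemma coupling_step_le:
  assumes "\<theta> > 0" "\<eta> \<ge> 0"
    and \<eta>: "\<eta> * b * L * \<theta> = 1 - \<theta>" and \<phi>: "\<phi> * L = 1 - \<theta>"
    and y: "y = \<theta> *\<^sub>R z + (1 - \<theta>) *\<^sub>R w - \<phi> *\<^sub>R d"
  shows "- 2 * \<eta> * (gradient F y \<bullet> (z - u))
      + \<eta>\<^sup>2 * b * (2 * L * (F w - F y - gradient F y \<bullet> (w - y)) + 2 * (gradient F y \<bullet> d))
    \<le> - (2 * \<eta> / \<theta>) * (F y - F u) + 2 * \<eta> * ((1 - \<theta>) / \<theta>) * (F w - F u)"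
proof -
  define g where "g = gradient F y"
  define Q where "Q = (1 - \<theta>) / \<theta>"
  \<comment> \<open>The definition of \<open>y\<close> is solved for \<open>z\<close>, so that the
    inner product with \<open>z - u\<close> splits into the directions \<open>y - u\<close>,
    \<open>w - y\<close> and \<open>d\<close>.\<close>
  have "\<theta> *\<^sub>R (z - u) = \<theta> *\<^sub>R (y - u) - (1 - \<theta>) *\<^sub>R (w - y) + \<phi> *\<^sub>R d"
    by (simp add: y algebra_simps)
  then have "\<theta> * (g \<bullet> (z - u)) = \<theta> * (g \<bullet> (y - u)) - (1 - \<theta>) * (g \<bullet> (w - y)) + \<phi> * (g \<bullet> d)"
    by (metis inner_add_right inner_diff_right inner_scaleR_right)
  then have "g \<bullet> (z - u) = g \<bullet> (y - u) - Q * (g \<bullet> (w - y)) + \<phi> / \<theta> * (g \<bullet> d)"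
    using \<open>\<theta> > 0\<close> by (simp add: Q_def field_simps)
  moreover have "\<phi> / \<theta> = Q / L"
    using \<open>\<theta> > 0\<close> L_pos \<phi> by (simp add: Q_def field_simps)
  ultimately have X: "g \<bullet> (z - u) = g \<bullet> (y - u) - Q * (g \<bullet> (w - y)) + (Q / L) * (g \<bullet> d)"
    by simp
  have "\<eta> * b = Q / L"
    using \<eta> \<open>\<theta> > 0\<close> L_pos by (simp add: Q_def field_simps)
  then have b: "\<eta>\<^sup>2 * b = \<eta> * (Q / L)"
    by (metis mult.assoc power2_eq_square)
  \<comment> \<open>The products with \<open>w - y\<close> occur with the coefficients
    \<open>2 * \<eta> * Q\<close> and \<open>- 2 * \<eta> * Q\<close>, those with \<open>d\<close>
    with \<open>- 2 * \<eta> * Q / L\<close> and \<open>2 * \<eta> * Q / L\<close>.\<close>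
  have "- 2 * \<eta> * (g \<bullet> (z - u)) + \<eta>\<^sup>2 * b * (2 * L * (F w - F y - g \<bullet> (w - y)) + 2 * (g \<bullet> d))
      = - 2 * \<eta> * (g \<bullet> (y - u)) + 2 * \<eta> * Q * (F w - F y)"
    unfolding X b using L_pos by (simp add: field_simps)
  also have "\<dots> \<le> - 2 * \<eta> * (F y - F u) + 2 * \<eta> * Q * (F w - F y)"
    using F_lower_bound[of y u] \<open>\<eta> \<ge> 0\<close>
    by (simp add: g_def inner_diff_right mult_left_mono)
  \<comment> \<open>Uses \<open>1 + Q = 1 / \<theta>\<close> to measure both gaps from
    \<open>F u\<close>.\<close>
  also have "\<dots> = - (2 * \<eta> / \<theta>) * (F y - F u) + 2 * \<eta> * Q * (F w - F u)"
    using \<open>\<theta> > 0\<close> by (simp add: Q_def field_simps)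
  finally show ?thesis by (simp add: g_def Q_def)
qed

section \<open>Measurability and integrability of the objective and its gradients\<close>

lemma lipschitz_gradient:
  assumes "L_smooth L g"
  shows "L-lipschitz_on UNIV (gradient g)"
  using L_smooth_gradient_lipschitz[OF assms] L_pos
  by (intro lipschitz_onI) (auto simp: dist_norm)

lemma measurable_gradient:
  assumes "L_smooth L g"
  shows "gradient g \<in> borel_measurable borel"
  using lipschitz_on_continuous_on[OF lipschitz_gradient[OF assms]]
  by (rule borel_measurable_continuous_onI)

lemma measurable_mult_vec: "(*v) (A :: real ^ 'd ^ 'd) \<in> borel_measurable borel"
  by (intro borel_measurable_continuous_onI linear_continuous_on matrix_vector_mul_bounded_linear)

lemma measurable_est:
  assumes i: "i \<in> {1..n}" and [measurable]: "Y \<in> borel_measurable A" "W \<in> borel_measurable A"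
  shows "(\<lambda>\<xi>. est i (Y \<xi>) (W \<xi>)) \<in> borel_measurable A"
proof -
  note [measurable] = measurable_gradient[OF smooth[OF i]] measurable_gradient[OF L_smooth_mean]
    measurable_mult_vec
  show ?thesis unfolding est_def by measurable
qed

text \<open>Smoothness bounds \<open>F\<close> from above by a quadratic and convexity bounds it
  from below by its tangent at 0. Square-integrability of a point therefore makes its objective
  value integrable.\<close>

lemma abs_F_le: "\<bar>F x\<bar> \<le> \<bar>F 0\<bar> + norm (gradient F 0) * norm x + L / 2 * (norm x)\<^sup>2"
proof -
  have "F x \<le> F 0 + gradient F 0 \<bullet> x + L / 2 * (norm x)\<^sup>2"
    using L_smooth_upper_bound[OF L_smooth_mean, of x 0] by simp
  moreover have "F x \<ge> F 0 + gradient F 0 \<bullet> x"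
    using F_lower_bound[of 0 x] by simp
  moreover have "\<bar>gradient F 0 \<bullet> x\<bar> \<le> norm (gradient F 0) * norm x"
    by (rule Cauchy_Schwarz_ineq2)
  moreover have "L / 2 * (norm x)\<^sup>2 \<ge> 0" using L_pos by simp
  ultimately show ?thesis by linarith
qed

lemma measurable_F: "F \<in> borel_measurable borel"
proof (rule borel_measurable_continuous_onI)
  have "isCont F x" for x
    using gderiv_mean[of x] unfolding gderiv_def by (rule has_derivative_continuous)
  then show "continuous_on UNIV F" by (simp add: continuous_at_imp_continuous_on)
qed

lemma integrable_F:
  assumes "finite_measure M" and X: "sq_integrable M X"
  shows "integrable M (\<lambda>\<xi>. F (X \<xi>))"
proof (rule Bochner_Integration.integrable_bound)
  interpret finite_measure M by fact
  show "integrable M (\<lambda>\<xi>. \<bar>F 0\<bar> + norm (gradient F 0) * norm (X \<xi>) + L / 2 * (norm (X \<xi>))\<^sup>2)"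
    using sq_integrable_integrable[OF X] X by (simp add: sq_integrable_def)
  show "(\<lambda>\<xi>. F (X \<xi>)) \<in> borel_measurable M"
    using measurable_compose[OF sq_integrable_measurable[OF X] measurable_F] .
  show "AE \<xi> in M. norm (F (X \<xi>))
      \<le> norm (\<bar>F 0\<bar> + norm (gradient F 0) * norm (X \<xi>) + L / 2 * (norm (X \<xi>))\<^sup>2)"
    using abs_F_le by (intro AE_I2) (auto intro: order_trans[OF _ abs_ge_self])
qed

end

section \<open>One epoch\<close>

text \<open>The estimates use the delay matrices only through this coordinatewise contraction, which
  holds at each outcome separately.\<close>

lemma zero_one_diagonal_mult_vec_le:
  assumes "zero_one_diagonal A"
  shows "\<bar>(A *v x) $ v\<bar> \<le> \<bar>x $ v\<bar>"
proof -
  have "(A *v x) $ v = (\<Sum>w\<in>UNIV. if w = v then A $ v $ v * x $ v else 0)"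
    unfolding matrix_vector_mult_def using assms
    by (simp only: vec_lambda_beta, intro sum.cong) (auto simp: zero_one_diagonal_def)
  then have "(A *v x) $ v = A $ v $ v * x $ v" by simp
  moreover have "A $ v $ v = 0 \<or> A $ v $ v = 1"
    using assms by (auto simp: zero_one_diagonal_def)
  ultimately show ?thesis by auto
qed

text \<open>A window contains at most \<open>\<tau>\<close> indices, and conversely \<open>j\<close>
  lies only in the windows of \<open>j + 1\<close>, ..., \<open>j + \<tau>\<close>. Each
  \<open>e k\<close> is thus counted at most \<open>\<tau>\<close> times in either role. Truncated
  subtraction only shortens the first windows.\<close>

lemma sum_delayed_le:
  fixes e :: "nat \<Rightarrow> real"
  assumes "\<And>k. e k \<ge> 0"
  shows "(\<Sum>k<m. \<Sum>j\<in>{k - \<tau>..<k}. e j + e k) \<le> 2 * real \<tau> * (\<Sum>k<m. e k)"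
proof -
  have "(\<Sum>k<m. \<Sum>j\<in>{k - \<tau>..<k}. e j) = (\<Sum>k<m. \<Sum>j<m. if j \<in> {k - \<tau>..<k} then e j else 0)"
  proof (rule sum.cong[OF refl])
    fix k assume "k \<in> {..<m}"
    then have "{k - \<tau>..<k} = {j \<in> {..<m}. j \<in> {k - \<tau>..<k}}" by auto
    then show "(\<Sum>j\<in>{k - \<tau>..<k}. e j) = (\<Sum>j<m. if j \<in> {k - \<tau>..<k} then e j else 0)"
      by (rule trans[OF arg_cong[where f = "sum e"] sum.inter_filter]) simp
  qed
  also have "\<dots> = (\<Sum>j<m. \<Sum>k<m. if j \<in> {k - \<tau>..<k} then e j else 0)"
    by (rule sum.swap)
  also have "\<dots> \<le> (\<Sum>j<m. real \<tau> * e j)"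
  proof (rule sum_mono)
    fix j
    have "{k \<in> {..<m}. j \<in> {k - \<tau>..<k}} \<subseteq> {j<..j + \<tau>}" by auto
    from card_mono[OF _ this] have "card {k \<in> {..<m}. j \<in> {k - \<tau>..<k}} \<le> \<tau>" by simp
    then have "real (card {k \<in> {..<m}. j \<in> {k - \<tau>..<k}}) * e j \<le> real \<tau> * e j"
      using assms by (intro mult_right_mono) auto
    then show "(\<Sum>k<m. if j \<in> {k - \<tau>..<k} then e j else 0) \<le> real \<tau> * e j"
      by (subst sum.inter_filter[symmetric]) simp_all
  qed
  finally have 1: "(\<Sum>k<m. \<Sum>j\<in>{k - \<tau>..<k}. e j) \<le> real \<tau> * (\<Sum>k<m. e k)"
    by (simp add: sum_distrib_left)
  have "(\<Sum>k<m. \<Sum>j\<in>{k - \<tau>..<k}. e k) \<le> (\<Sum>k<m. real \<tau> * e k)"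
    using assms by (intro sum_mono) (auto intro!: mult_right_mono)
  then have 2: "(\<Sum>k<m. \<Sum>j\<in>{k - \<tau>..<k}. e k) \<le> real \<tau> * (\<Sum>k<m. e k)"
    by (simp add: sum_distrib_left)
  from 1 2 show ?thesis by (simp add: sum.distrib)
qed

text \<open>One epoch with fixed round and epoch numbers and a random snapshot \<open>w\<close>. The
  last three assumptions are the state inherited from the preceding epochs.\<close>

locale async_epoch = prob_space M + sparse_convex_sum f n T L
  for M :: "'w measure"
    and f :: "nat \<Rightarrow> real ^ 'd::finite \<Rightarrow> real"
    and n :: nat
    and T :: "nat \<Rightarrow> 'd set"
    and L :: real +
  fixes m \<tau> :: nat
    and \<theta> \<phi> \<eta> :: real
    and A :: "nat \<Rightarrow> 'w measure"
    and idx :: "nat \<Rightarrow> 'w \<Rightarrow> nat"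
    and J :: "nat \<Rightarrow> nat \<Rightarrow> 'w \<Rightarrow> real ^ 'd ^ 'd"
    and zhat yhat G z :: "nat \<Rightarrow> 'w \<Rightarrow> real ^ 'd"
    and w :: "'w \<Rightarrow> real ^ 'd"
  assumes yhat_eq: "\<And>k \<xi>. k < m \<Longrightarrow> \<xi> \<in> space M \<Longrightarrow>
      yhat k \<xi> = \<theta> *\<^sub>R zhat k \<xi> + (1 - \<theta>) *\<^sub>R w \<xi> - \<phi> *\<^sub>R (reweight n T *v gradient F (w \<xi>))"
    and G_eq: "\<And>k \<xi>. k < m \<Longrightarrow> \<xi> \<in> space M \<Longrightarrow> G k \<xi> = est (idx k \<xi>) (yhat k \<xi>) (w \<xi>)"
    and z_Suc: "\<And>k \<xi>. k < m \<Longrightarrow> \<xi> \<in> space M \<Longrightarrow> z (Suc k) \<xi> = z k \<xi> - \<eta> *\<^sub>R G k \<xi>"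
    and J_zero_one: "\<And>k j \<xi>. k < m \<Longrightarrow> j \<in> {k - \<tau>..<k} \<Longrightarrow> \<xi> \<in> space M \<Longrightarrow> zero_one_diagonal (J k j \<xi>)"
    and zhat_eq: "\<And>k \<xi>. k < m \<Longrightarrow> \<xi> \<in> space M \<Longrightarrow>
      zhat k \<xi> = z k \<xi> + \<eta> *\<^sub>R (\<Sum>j\<in>{k - \<tau>..<k}. J k j \<xi> *v G j \<xi>)"
    and A_subalgebra: "\<And>k. k \<le> m \<Longrightarrow> subalgebra M (A k)"
    and A_update: "\<And>k. k < m \<Longrightarrow> subalgebra (A (Suc k)) (A k)"
    and zhat_measurable: "\<And>k. k < m \<Longrightarrow> zhat k \<in> borel_measurable (A k)"
    and idx_measurable: "\<And>k. k < m \<Longrightarrow> idx k \<in> A (Suc k) \<rightarrow>\<^sub>M count_space {1..n}"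
    and idx_uniform: "\<And>k. k < m \<Longrightarrow> distr M (count_space {1..n}) (idx k) = uniform_count_measure {1..n}"
    and idx_indep: "\<And>k. k < m \<Longrightarrow>
      indep_set (sets (vimage_algebra (space M) (idx k) (count_space {1..n}))) (sets (A k))"
    and w_measurable: "w \<in> borel_measurable (A 0)"
    and w_sq: "sq_integrable M w"
    and z0_sq: "sq_integrable M (z 0)"
begin

section \<open>Measurability along the filtration of one epoch\<close>

lemma A_mono:
  assumes "j \<le> k" "k \<le> m"
  shows "subalgebra (A k) (A j)"
  using assms
proof (induction k rule: dec_induct)
  case base
  show ?case by (simp add: subalgebra_def)
next
  case (step k)
  then have "subalgebra (A (Suc k)) (A k)" "subalgebra (A k) (A j)"
    using A_update by auto
  then show ?case by (auto simp: subalgebra_def)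
qed

lemma space_A: "k \<le> m \<Longrightarrow> space (A k) = space M"
  using A_subalgebra by (simp add: subalgebra_def)

lemma w_measurable': "k \<le> m \<Longrightarrow> w \<in> borel_measurable (A k)"
  using measurable_from_subalg[OF A_mono w_measurable] by simp

lemma idx_in: "k < m \<Longrightarrow> \<xi> \<in> space M \<Longrightarrow> idx k \<xi> \<in> {1..n}"
  using measurable_space[OF idx_measurable] space_A by fastforce

lemma idx_measurable_M: "k < m \<Longrightarrow> idx k \<in> M \<rightarrow>\<^sub>M count_space {1..n}"
  using measurable_from_subalg[OF A_subalgebra idx_measurable] by simp

lemma yhat_measurable:
  assumes k: "k < m"
  shows "yhat k \<in> borel_measurable (A k)"
proof -
  note [measurable] = zhat_measurable[OF k] w_measurable'[OF less_imp_le[OF k]]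
    measurable_gradient[OF L_smooth_mean] measurable_mult_vec
  have "(\<lambda>\<xi>. \<theta> *\<^sub>R zhat k \<xi> + (1 - \<theta>) *\<^sub>R w \<xi> - \<phi> *\<^sub>R (reweight n T *v gradient F (w \<xi>)))
      \<in> borel_measurable (A k)"
    by measurable
  then show ?thesis
    using k by (subst measurable_cong[OF yhat_eq]) (auto simp: space_A)
qed

lemma G_measurable:
  assumes k: "k < m"
  shows "G k \<in> borel_measurable (A (Suc k))"
proof -
  have "(\<lambda>\<xi>. est (idx k \<xi>) (yhat k \<xi>) (w \<xi>)) \<in> borel_measurable (A (Suc k))"
  proof (rule measurable_compose_countable'[OF _ idx_measurable[OF k]])
    fix i assume "i \<in> {1..n}"
    then show "(\<lambda>\<xi>. est i (yhat k \<xi>) (w \<xi>)) \<in> borel_measurable (A (Suc k))"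
      using k by (intro measurable_est w_measurable'
          measurable_from_subalg[OF A_update yhat_measurable]) auto
  qed simp
  then show ?thesis
    using k by (subst measurable_cong[OF G_eq]) (auto simp: space_A)
qed

text \<open>Stochastic gradients of earlier steps are known before the sample \<open>idx k\<close>
  is drawn, so they act as constants when that sample is averaged out.\<close>

lemma G_measurable':
  assumes "j < k" "k \<le> m"
  shows "G j \<in> borel_measurable (A k)"
  using measurable_from_subalg[OF A_mono G_measurable] assms by simp

section \<open>Square-integrability of the iterates\<close>

lemma sq_integrable_est:
  assumes "i \<in> {1..n}" "sq_integrable M Y"
  shows "sq_integrable M (\<lambda>\<xi>. est i (Y \<xi>) (w \<xi>))"
  unfolding est_def
  by (intro sq_integrable_add sq_integrable_diff sq_integrable_lipschitz[OF _ lipschitz_gradient]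
      sq_integrable_bounded_linear[OF _ matrix_vector_mul_bounded_linear] smooth L_smooth_mean assms w_sq)

lemma sq_integrable_yhat:
  assumes k: "k < m" and "sq_integrable M (zhat k)"
  shows "sq_integrable M (yhat k)"
proof (subst sq_integrable_cong[OF yhat_eq[OF k]])
  show "sq_integrable M (\<lambda>\<xi>. \<theta> *\<^sub>R zhat k \<xi> + (1 - \<theta>) *\<^sub>R w \<xi> - \<phi> *\<^sub>R (reweight n T *v gradient F (w \<xi>)))"
    by (intro sq_integrable_add sq_integrable_diff sq_integrable_scaleR
        sq_integrable_lipschitz[OF _ lipschitz_gradient]
        sq_integrable_bounded_linear[OF _ matrix_vector_mul_bounded_linear] L_smooth_mean assms w_sq)
qed

lemma norm_J_mult_le:
  assumes "k < m" "j \<in> {k - \<tau>..<k}" "\<xi> \<in> space M"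
  shows "norm (J k j \<xi> *v x) \<le> norm x"
  by (rule norm_le_componentwise_cart)
    (simp add: zero_one_diagonal_mult_vec_le[OF J_zero_one[OF assms]])

text \<open>The single summands with \<open>J\<close> are not known to be measurable. Measurability
  of the read comes from the model, and integrability from a pointwise bound in which
  \<open>J\<close> no longer occurs.\<close>

lemma sq_integrable_zhat_aux:
  assumes k: "k < m" and "sq_integrable M (z k)" and "\<And>j. j < k \<Longrightarrow> sq_integrable M (G j)"
  shows "sq_integrable M (zhat k)"
proof (rule sq_integrable_dominated)
  show "sq_integrable M (\<lambda>\<xi>. norm (z k \<xi>) + \<bar>\<eta>\<bar> *\<^sub>R (\<Sum>j\<in>{k - \<tau>..<k}. norm (G j \<xi>)))"
    using assms by (intro sq_integrable_add sq_integrable_scaleR sq_integrable_sum sq_integrable_norm) auto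
  show "zhat k \<in> borel_measurable M"
    using measurable_from_subalg[OF A_subalgebra zhat_measurable] k by simp
  fix \<xi> assume \<xi>: "\<xi> \<in> space M"
  have "norm (\<Sum>j\<in>{k - \<tau>..<k}. J k j \<xi> *v G j \<xi>) \<le> (\<Sum>j\<in>{k - \<tau>..<k}. norm (G j \<xi>))"
    using norm_J_mult_le[OF k _ \<xi>] by (intro sum_norm_le) auto
  then have "norm (zhat k \<xi>) \<le> norm (z k \<xi>) + \<bar>\<eta>\<bar> * (\<Sum>j\<in>{k - \<tau>..<k}. norm (G j \<xi>))"
    unfolding zhat_eq[OF k \<xi>]
    by (intro order_trans[OF norm_triangle_ineq]) (simp add: mult_left_mono)
  then show "norm (zhat k \<xi>) \<le> norm (norm (z k \<xi>) + \<bar>\<eta>\<bar> *\<^sub>R (\<Sum>j\<in>{k - \<tau>..<k}. norm (G j \<xi>)))"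
    by simp
qed

lemma sq_integrable_G_aux:
  assumes k: "k < m" and y: "sq_integrable M (yhat k)"
  shows "sq_integrable M (G k)"
proof (rule sq_integrable_dominated)
  show "sq_integrable M (\<lambda>\<xi>. \<Sum>i=1..n. norm (est i (yhat k \<xi>) (w \<xi>)))"
    by (intro sq_integrable_sum sq_integrable_norm sq_integrable_est y) auto
  show "G k \<in> borel_measurable M"
    using measurable_from_subalg[OF A_subalgebra G_measurable] k by simp
  fix \<xi> assume \<xi>: "\<xi> \<in> space M"
  have "norm (est (idx k \<xi>) (yhat k \<xi>) (w \<xi>)) \<le> (\<Sum>i=1..n. norm (est i (yhat k \<xi>) (w \<xi>)))"
    by (rule member_le_sum[OF idx_in[OF k \<xi>]]) auto
  then show "norm (G k \<xi>) \<le> norm (\<Sum>i=1..n. norm (est i (yhat k \<xi>) (w \<xi>)))"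
    unfolding G_eq[OF k \<xi>] by (simp add: abs_of_nonneg sum_nonneg)
qed

text \<open>A joint induction is forced by the dependencies: the read at \<open>k\<close> involves
  \<open>z k\<close> and earlier gradients, \<open>G k\<close> involves the read, and
  \<open>z (Suc k)\<close> involves \<open>G k\<close>.\<close>

lemma sq_integrable_z_G: "k \<le> m \<Longrightarrow> sq_integrable M (z k) \<and> (\<forall>j<k. sq_integrable M (G j))"
proof (induction k)
  case 0
  show ?case by (simp add: z0_sq)
next
  case (Suc k)
  then have k: "k < m" and IH: "sq_integrable M (z k)" "\<forall>j<k. sq_integrable M (G j)" by auto
  have G: "sq_integrable M (G k)"
    by (rule sq_integrable_G_aux[OF k sq_integrable_yhat[OF k sq_integrable_zhat_aux[OF k IH(1)]]])
      (use IH(2) in simp)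
  have "sq_integrable M (z (Suc k))"
    using sq_integrable_diff[OF IH(1) sq_integrable_scaleR[OF G, of \<eta>]]
    by (subst sq_integrable_cong[OF z_Suc[OF k]])
  then show ?case using IH(2) G less_Suc_eq by auto
qed

lemma sq_integrable_z: "k \<le> m \<Longrightarrow> sq_integrable M (z k)"
  and sq_integrable_G: "k < m \<Longrightarrow> sq_integrable M (G k)"
  using sq_integrable_z_G[of k] sq_integrable_z_G[of "Suc k"] by auto

lemma sq_integrable_zhat: "k < m \<Longrightarrow> sq_integrable M (zhat k)"
  by (rule sq_integrable_zhat_aux) (simp_all add: sq_integrable_z sq_integrable_G)

lemma sq_integrable_yhat': "k < m \<Longrightarrow> sq_integrable M (yhat k)"
  by (rule sq_integrable_yhat[OF _ sq_integrable_zhat])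


section \<open>Averaging over a sample that is independent of the past\<close>

lemma expectation_idx:
  assumes k: "k < m"
    and meas: "\<And>i. i \<in> {1..n} \<Longrightarrow> h i \<in> borel_measurable (A k)"
    and int: "\<And>i. i \<in> {1..n} \<Longrightarrow> integrable M (h i)"
  shows "expectation (\<lambda>\<xi>. h (idx k \<xi>) \<xi>) = expectation (\<lambda>\<xi>. (1 / real n) * (\<Sum>i=1..n. h i \<xi>))"
proof -
  have "expectation (\<lambda>\<xi>. h (idx k \<xi>) \<xi>) = (1 / real (card {1..n})) * (\<Sum>i=1..n. expectation (h i))"
    using n_pos
    by (rule_tac expectation_uniform_index(2)[OF _ _ idx_measurable_M[OF k] idx_uniform[OF k] idx_indep[OF k]
          A_subalgebra[OF less_imp_le[OF k]] meas int]) auto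
  also have "\<dots> = expectation (\<lambda>\<xi>. (1 / real n) * (\<Sum>i=1..n. h i \<xi>))"
    using int by (simp del: One_nat_def)
  finally show ?thesis .
qed

lemma measurable_est_yhat:
  assumes "k < m" "i \<in> {1..n}"
  shows "(\<lambda>\<xi>. est i (yhat k \<xi>) (w \<xi>)) \<in> borel_measurable (A k)"
  using assms by (intro measurable_est yhat_measurable w_measurable') auto

lemma sq_integrable_est_yhat:
  "k < m \<Longrightarrow> i \<in> {1..n} \<Longrightarrow> sq_integrable M (\<lambda>\<xi>. est i (yhat k \<xi>) (w \<xi>))"
  by (rule sq_integrable_est[OF _ sq_integrable_yhat'])

lemma sq_integrable_gradient: "sq_integrable M Y \<Longrightarrow> sq_integrable M (\<lambda>\<xi>. gradient F (Y \<xi>))"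
  by (rule sq_integrable_lipschitz[OF _ lipschitz_gradient[OF L_smooth_mean]])

lemma integrable_power2_norm: "sq_integrable M X \<Longrightarrow> integrable M (\<lambda>\<xi>. (norm (X \<xi>))\<^sup>2)"
  by (simp add: sq_integrable_def)

text \<open>The offset \<open>zhat k - u\<close> is \<open>A k\<close>-measurable and stays fixed
  while the sample is averaged out, so \<open>mean_est\<close> applies under the
  expectation.\<close>

lemma expectation_G_inner:
  assumes k: "k < m"
  shows "expectation (\<lambda>\<xi>. G k \<xi> \<bullet> (zhat k \<xi> - u))
    = expectation (\<lambda>\<xi>. gradient F (yhat k \<xi>) \<bullet> (zhat k \<xi> - u))"
proof -
  have sq: "sq_integrable M (\<lambda>\<xi>. zhat k \<xi> - u)"
    by (rule sq_integrable_diff[OF sq_integrable_zhat[OF k] sq_integrable_const])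
  have "expectation (\<lambda>\<xi>. G k \<xi> \<bullet> (zhat k \<xi> - u))
      = expectation (\<lambda>\<xi>. est (idx k \<xi>) (yhat k \<xi>) (w \<xi>) \<bullet> (zhat k \<xi> - u))"
    by (rule Bochner_Integration.integral_cong) (simp_all add: G_eq[OF k])
  also have "\<dots> = expectation (\<lambda>\<xi>. (1 / real n) * (\<Sum>i=1..n. est i (yhat k \<xi>) (w \<xi>) \<bullet> (zhat k \<xi> - u)))"
  proof (rule expectation_idx[OF k, where h = "\<lambda>i \<xi>. est i (yhat k \<xi>) (w \<xi>) \<bullet> (zhat k \<xi> - u)"])
    fix i assume i: "i \<in> {1..n}"
    note [measurable] = measurable_est_yhat[OF k i] zhat_measurable[OF k]
    show "(\<lambda>\<xi>. est i (yhat k \<xi>) (w \<xi>) \<bullet> (zhat k \<xi> - u)) \<in> borel_measurable (A k)"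
      by measurable
    show "integrable M (\<lambda>\<xi>. est i (yhat k \<xi>) (w \<xi>) \<bullet> (zhat k \<xi> - u))"
      by (rule integrable_inner_sq_integrable[OF sq_integrable_est_yhat[OF k i] sq])
  qed
  also have "\<dots> = expectation (\<lambda>\<xi>. gradient F (yhat k \<xi>) \<bullet> (zhat k \<xi> - u))"
  proof -
    have "(1 / real n) * (\<Sum>i=1..n. est i y x \<bullet> v) = gradient F y \<bullet> v" for y x v
      unfolding mean_est[of y x, symmetric] by (simp add: inner_sum_left)
    then show ?thesis by (simp only:)
  qed
  finally show ?thesis .
qed

lemma expectation_norm_G:
  assumes k: "k < m"
  shows "expectation (\<lambda>\<xi>. (norm (G k \<xi>))\<^sup>2)
    = expectation (\<lambda>\<xi>. (1 / real n) * (\<Sum>i=1..n. (norm (est i (yhat k \<xi>) (w \<xi>)))\<^sup>2))"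
proof -
  have "expectation (\<lambda>\<xi>. (norm (G k \<xi>))\<^sup>2)
      = expectation (\<lambda>\<xi>. (norm (est (idx k \<xi>) (yhat k \<xi>) (w \<xi>)))\<^sup>2)"
    by (rule Bochner_Integration.integral_cong) (simp_all add: G_eq[OF k])
  also have "\<dots> = expectation (\<lambda>\<xi>. (1 / real n) * (\<Sum>i=1..n. (norm (est i (yhat k \<xi>) (w \<xi>)))\<^sup>2))"
  proof (rule expectation_idx[OF k, where h = "\<lambda>i \<xi>. (norm (est i (yhat k \<xi>) (w \<xi>)))\<^sup>2"])
    fix i assume i: "i \<in> {1..n}"
    note [measurable] = measurable_est_yhat[OF k i]
    show "(\<lambda>\<xi>. (norm (est i (yhat k \<xi>) (w \<xi>)))\<^sup>2) \<in> borel_measurable (A k)"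
      by measurable
    show "integrable M (\<lambda>\<xi>. (norm (est i (yhat k \<xi>) (w \<xi>)))\<^sup>2)"
      by (rule integrable_power2_norm[OF sq_integrable_est_yhat[OF k i]])
  qed
  finally show ?thesis .
qed

text \<open>The right-hand side of \<open>mean_norm_est_le\<close>, kept whole because its inner
  products cancel only later, against the linear term of the step.\<close>

definition variance_bound :: "real ^ 'd \<Rightarrow> real ^ 'd \<Rightarrow> real" where
  "variance_bound y x = 2 * L * (F x - F y - gradient F y \<bullet> (x - y))
     + 2 * (gradient F y \<bullet> (reweight n T *v gradient F x))"

lemma integrable_mean_norm_est:
  assumes "k < m"
  shows "integrable M (\<lambda>\<xi>. (1 / real n) * (\<Sum>i=1..n. (norm (est i (yhat k \<xi>) (w \<xi>)))\<^sup>2))"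
  by (intro integrable_mult_right Bochner_Integration.integrable_sum integrable_power2_norm
      sq_integrable_est_yhat assms)

lemma integrable_F': "sq_integrable M X \<Longrightarrow> integrable M (\<lambda>\<xi>. F (X \<xi>))"
  by (rule integrable_F[OF finite_measure_axioms])

lemma integrable_variance_bound:
  assumes k: "k < m"
  shows "integrable M (\<lambda>\<xi>. variance_bound (yhat k \<xi>) (w \<xi>))"
proof -
  note y = sq_integrable_yhat'[OF k]
  have "integrable M (\<lambda>\<xi>. gradient F (yhat k \<xi>) \<bullet> (w \<xi> - yhat k \<xi>))"
    by (rule integrable_inner_sq_integrable[OF sq_integrable_gradient[OF y] sq_integrable_diff[OF w_sq y]])
  moreover have "integrable M (\<lambda>\<xi>. gradient F (yhat k \<xi>) \<bullet> (reweight n T *v gradient F (w \<xi>)))"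
    by (rule integrable_inner_sq_integrable[OF sq_integrable_gradient[OF y]
          sq_integrable_bounded_linear[OF sq_integrable_gradient[OF w_sq] matrix_vector_mul_bounded_linear]])
  ultimately show ?thesis
    unfolding variance_bound_def using integrable_F'[OF w_sq] integrable_F'[OF y] by simp
qed

lemma expectation_norm_G_le:
  assumes k: "k < m"
  shows "expectation (\<lambda>\<xi>. (norm (G k \<xi>))\<^sup>2) \<le> expectation (\<lambda>\<xi>. variance_bound (yhat k \<xi>) (w \<xi>))"
  unfolding expectation_norm_G[OF k] variance_bound_def
  by (intro integral_mono integrable_mean_norm_est[OF k] integrable_variance_bound[OF k, unfolded variance_bound_def]
      mean_norm_est_le)

text \<open>Dominates the inner product of \<open>G k\<close> with \<open>J *v G j\<close> for every
  diagonal 0-1 matrix \<open>J\<close>, which plain Cauchy-Schwarz would also do but without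
  retaining the sparsity.\<close>

definition overlap_term :: "nat \<Rightarrow> nat \<Rightarrow> 'w \<Rightarrow> real" where
  "overlap_term j k \<xi> = (\<Sum>v\<in>UNIV. \<bar>G j \<xi> $ v\<bar> * \<bar>G k \<xi> $ v\<bar>)"

lemma integrable_overlap_term: "j < m \<Longrightarrow> k < m \<Longrightarrow> integrable M (overlap_term j k)"
  unfolding overlap_term_def[abs_def]
  by (intro Bochner_Integration.integrable_sum integrable_abs_nth_mult sq_integrable_G)

text \<open>Since \<open>j < k\<close>, the vector \<open>G j\<close> is fixed while
  \<open>idx k\<close> is averaged out. The candidates for \<open>G k\<close> vanish off their
  supports, so \<open>mean_sparse_product_le\<close> supplies the factor
  \<open>sqrt \<Delta>\<close>.\<close>

lemma expectation_overlap_term_le: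
  assumes j: "j < k" and k: "k < m"
  shows "expectation (overlap_term j k) \<le> sqrt (max_overlap n T) / 2 *
    (expectation (\<lambda>\<xi>. (norm (G j \<xi>))\<^sup>2) + expectation (\<lambda>\<xi>. (norm (G k \<xi>))\<^sup>2))"
proof -
  let ?h = "\<lambda>i \<xi>. \<Sum>v\<in>UNIV. \<bar>G j \<xi> $ v\<bar> * \<bar>est i (yhat k \<xi>) (w \<xi>) $ v\<bar>"
  have jm: "j < m" using j k by simp
  have int: "integrable M (?h i)" if i: "i \<in> {1..n}" for i
    by (intro Bochner_Integration.integrable_sum integrable_abs_nth_mult sq_integrable_G[OF jm]
        sq_integrable_est_yhat[OF k i])
  have "expectation (overlap_term j k) = expectation (\<lambda>\<xi>. ?h (idx k \<xi>) \<xi>)"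
    unfolding overlap_term_def[abs_def]
    by (rule Bochner_Integration.integral_cong) (simp_all add: G_eq[OF k])
  also have "\<dots> = expectation (\<lambda>\<xi>. (1 / real n) * (\<Sum>i=1..n. ?h i \<xi>))"
  proof (rule expectation_idx[OF k, where h = ?h])
    fix i assume i: "i \<in> {1..n}"
    note [measurable] = measurable_est_yhat[OF k i] G_measurable'[OF j less_imp_le[OF k]]
    have [measurable]: "(\<lambda>x :: real ^ 'd. x $ v) \<in> borel_measurable borel" for v by measurable
    show "?h i \<in> borel_measurable (A k)" by measurable
    show "integrable M (?h i)" by (rule int[OF i])
  qed
  also have "\<dots> \<le> expectation (\<lambda>\<xi>. sqrt (max_overlap n T) / 2 * ((norm (G j \<xi>))\<^sup>2
      + (1 / real n) * (\<Sum>i=1..n. (norm (est i (yhat k \<xi>) (w \<xi>)))\<^sup>2)))"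
    by (intro integral_mono integrable_mult_right Bochner_Integration.integrable_sum int
        Bochner_Integration.integrable_add integrable_power2_norm sq_integrable_G[OF jm]
        sq_integrable_est_yhat[OF k] mean_sparse_product_le est_nth_eq_0)
  also have "\<dots> = sqrt (max_overlap n T) / 2 *
      (expectation (\<lambda>\<xi>. (norm (G j \<xi>))\<^sup>2) + expectation (\<lambda>\<xi>. (norm (G k \<xi>))\<^sup>2))"
    unfolding expectation_norm_G[OF k]
    using Bochner_Integration.integral_add[OF integrable_power2_norm[OF sq_integrable_G[OF jm]]
        integrable_mean_norm_est[OF k]]
    by (simp only: integral_mult_right_zero)
  finally show ?thesis .
qed

text \<open>Expanding the square produces the inner product with \<open>z k - u\<close>, whereas the
  point \<open>yhat k\<close> is built from \<open>zhat k\<close>. Exchanging the two costs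
  \<open>2 * \<eta>\<^sup>2 * (G k \<xi> \<bullet> e)\<close>, with \<open>e\<close> the sum of the
  missing updates.\<close>

lemma norm_z_Suc_le:
  assumes k: "k < m" and \<xi>: "\<xi> \<in> space M" and \<eta>: "\<eta> \<ge> 0"
  shows "(norm (z (Suc k) \<xi> - u))\<^sup>2 \<le> (norm (z k \<xi> - u))\<^sup>2 - 2 * \<eta> * (G k \<xi> \<bullet> (zhat k \<xi> - u))
    + 2 * \<eta>\<^sup>2 * (\<Sum>j\<in>{k - \<tau>..<k}. overlap_term j k \<xi>) + \<eta>\<^sup>2 * (norm (G k \<xi>))\<^sup>2"
proof -
  define e where "e = (\<Sum>j\<in>{k - \<tau>..<k}. J k j \<xi> *v G j \<xi>)"
  have zhat: "zhat k \<xi> = z k \<xi> + \<eta> *\<^sub>R e"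
    by (simp add: e_def zhat_eq[OF k \<xi>])
  have "G k \<xi> \<bullet> (J k j \<xi> *v G j \<xi>) \<le> overlap_term j k \<xi>" if j: "j \<in> {k - \<tau>..<k}" for j
    unfolding inner_vec_def overlap_term_def
  proof (rule sum_mono)
    fix v
    have "(G k \<xi> $ v) * (J k j \<xi> *v G j \<xi>) $ v \<le> \<bar>G k \<xi> $ v\<bar> * \<bar>(J k j \<xi> *v G j \<xi>) $ v\<bar>"
      by (metis abs_ge_self abs_mult)
    also have "\<dots> \<le> \<bar>G k \<xi> $ v\<bar> * \<bar>G j \<xi> $ v\<bar>"
      by (intro mult_left_mono zero_one_diagonal_mult_vec_le J_zero_one[OF k j \<xi>]) simp
    finally show "inner (G k \<xi> $ v) ((J k j \<xi> *v G j \<xi>) $ v) \<le> \<bar>G j \<xi> $ v\<bar> * \<bar>G k \<xi> $ v\<bar>"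
      by (simp add: mult.commute)
  qed
  then have "G k \<xi> \<bullet> e \<le> (\<Sum>j\<in>{k - \<tau>..<k}. overlap_term j k \<xi>)"
    unfolding e_def inner_sum_right by (rule sum_mono)
  then have "2 * \<eta>\<^sup>2 * (G k \<xi> \<bullet> e) \<le> 2 * \<eta>\<^sup>2 * (\<Sum>j\<in>{k - \<tau>..<k}. overlap_term j k \<xi>)"
    by (intro mult_left_mono) auto
  moreover have "(norm (z (Suc k) \<xi> - u))\<^sup>2 = (norm (z k \<xi> - u))\<^sup>2 - 2 * \<eta> * (G k \<xi> \<bullet> (zhat k \<xi> - u))
      + 2 * \<eta>\<^sup>2 * (G k \<xi> \<bullet> e) + \<eta>\<^sup>2 * (norm (G k \<xi>))\<^sup>2"
  proof -
    have expand: "(norm (a - \<eta> *\<^sub>R g))\<^sup>2 = (norm a)\<^sup>2 - 2 * \<eta> * (g \<bullet> a) + \<eta>\<^sup>2 * (norm g)\<^sup>2"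
      for a g :: "real ^ 'd"
      unfolding power2_norm_eq_inner
      by (simp add: inner_diff_left inner_diff_right inner_commute[of a g] power2_eq_square algebra_simps)
    have "z (Suc k) \<xi> - u = (z k \<xi> - u) - \<eta> *\<^sub>R G k \<xi>" by (simp add: z_Suc[OF k \<xi>])
    then have "(norm (z (Suc k) \<xi> - u))\<^sup>2
        = (norm (z k \<xi> - u))\<^sup>2 - 2 * \<eta> * (G k \<xi> \<bullet> (z k \<xi> - u)) + \<eta>\<^sup>2 * (norm (G k \<xi>))\<^sup>2"
      by (simp only: expand)
    moreover have "G k \<xi> \<bullet> (zhat k \<xi> - u) = G k \<xi> \<bullet> (z k \<xi> - u) + \<eta> * (G k \<xi> \<bullet> e)"
      by (simp add: zhat inner_diff_right inner_add_right)
    ultimately show ?thesis by (simp add: power2_eq_square algebra_simps)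
  qed
  ultimately show ?thesis by simp
qed

lemma expectation_norm_z_Suc_le:
  fixes u :: "real ^ 'd"
  defines "e \<equiv> \<lambda>k. expectation (\<lambda>\<xi>. (norm (G k \<xi>))\<^sup>2)"
  assumes k: "k < m" and \<eta>: "\<eta> \<ge> 0"
  shows "expectation (\<lambda>\<xi>. (norm (z (Suc k) \<xi> - u))\<^sup>2) \<le> expectation (\<lambda>\<xi>. (norm (z k \<xi> - u))\<^sup>2)
    - 2 * \<eta> * expectation (\<lambda>\<xi>. gradient F (yhat k \<xi>) \<bullet> (zhat k \<xi> - u))
    + \<eta>\<^sup>2 * sqrt (max_overlap n T) * (\<Sum>j\<in>{k - \<tau>..<k}. e j + e k) + \<eta>\<^sup>2 * e k"
proof -
  have i1: "integrable M (\<lambda>\<xi>. (norm (z k' \<xi> - u))\<^sup>2)" if "k' \<le> m" for k'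
    by (rule integrable_power2_norm[OF sq_integrable_diff[OF sq_integrable_z[OF that] sq_integrable_const]])
  have i2: "integrable M (\<lambda>\<xi>. G k \<xi> \<bullet> (zhat k \<xi> - u))"
    by (rule integrable_inner_sq_integrable[OF sq_integrable_G[OF k]
          sq_integrable_diff[OF sq_integrable_zhat[OF k] sq_integrable_const]])
  have i3: "integrable M (overlap_term j k)" if "j \<in> {k - \<tau>..<k}" for j
    using integrable_overlap_term that k by simp
  have i5: "integrable M (\<lambda>\<xi>. \<Sum>j\<in>{k - \<tau>..<k}. overlap_term j k \<xi>)"
    by (intro Bochner_Integration.integrable_sum i3)
  have i4: "integrable M (\<lambda>\<xi>. (norm (G k \<xi>))\<^sup>2)"
    by (rule integrable_power2_norm[OF sq_integrable_G[OF k]])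
  have "expectation (\<lambda>\<xi>. (norm (z (Suc k) \<xi> - u))\<^sup>2) \<le>
      expectation (\<lambda>\<xi>. (norm (z k \<xi> - u))\<^sup>2 - 2 * \<eta> * (G k \<xi> \<bullet> (zhat k \<xi> - u))
        + 2 * \<eta>\<^sup>2 * (\<Sum>j\<in>{k - \<tau>..<k}. overlap_term j k \<xi>) + \<eta>\<^sup>2 * (norm (G k \<xi>))\<^sup>2)"
    using k by (intro integral_mono i1 norm_z_Suc_le[OF k _ \<eta>] Bochner_Integration.integrable_add
        Bochner_Integration.integrable_diff integrable_mult_right Bochner_Integration.integrable_sum i2 i3 i4) auto
  also have "\<dots> = expectation (\<lambda>\<xi>. (norm (z k \<xi> - u))\<^sup>2) - 2 * \<eta> * expectation (\<lambda>\<xi>. G k \<xi> \<bullet> (zhat k \<xi> - u))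
        + 2 * \<eta>\<^sup>2 * (\<Sum>j\<in>{k - \<tau>..<k}. expectation (overlap_term j k)) + \<eta>\<^sup>2 * e k"
    using i1[OF less_imp_le[OF k]] i2 i4 i5 Bochner_Integration.integral_sum[of "{k - \<tau>..<k}", OF i3]
    by (simp add: e_def)
  \<comment> \<open>The factor 2 from the expansion cancels the one half in the sparse product
    bound.\<close>
  also have "(\<Sum>j\<in>{k - \<tau>..<k}. expectation (overlap_term j k))
      \<le> (\<Sum>j\<in>{k - \<tau>..<k}. sqrt (max_overlap n T) / 2 * (e j + e k))"
    unfolding e_def by (intro sum_mono expectation_overlap_term_le k) auto
  finally show ?thesis
    unfolding expectation_G_inner[OF k]
    by (simp add: sum_distrib_left[symmetric] sum_divide_distrib[symmetric] mult_left_mono mult.assoc)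
qed


lemma expectation_coupling_step_le:
  assumes k: "k < m"
    and "\<theta> > 0" "\<eta> \<ge> 0" "\<eta> * b * L * \<theta> = 1 - \<theta>" "\<phi> * L = 1 - \<theta>"
  shows "- 2 * \<eta> * expectation (\<lambda>\<xi>. gradient F (yhat k \<xi>) \<bullet> (zhat k \<xi> - u))
      + \<eta>\<^sup>2 * b * expectation (\<lambda>\<xi>. variance_bound (yhat k \<xi>) (w \<xi>))
    \<le> - (2 * \<eta> / \<theta>) * (expectation (\<lambda>\<xi>. F (yhat k \<xi>)) - F u)
      + 2 * \<eta> * ((1 - \<theta>) / \<theta>) * (expectation (\<lambda>\<xi>. F (w \<xi>)) - F u)"
proof -
  have i1: "integrable M (\<lambda>\<xi>. gradient F (yhat k \<xi>) \<bullet> (zhat k \<xi> - u))"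
    by (rule integrable_inner_sq_integrable[OF sq_integrable_gradient[OF sq_integrable_yhat'[OF k]]
          sq_integrable_diff[OF sq_integrable_zhat[OF k] sq_integrable_const]])
  note i2 = integrable_variance_bound[OF k]
  note i3 = integrable_F'[OF sq_integrable_yhat'[OF k]] integrable_F'[OF w_sq]
  have "expectation (\<lambda>\<xi>. - 2 * \<eta> * (gradient F (yhat k \<xi>) \<bullet> (zhat k \<xi> - u))
        + \<eta>\<^sup>2 * b * variance_bound (yhat k \<xi>) (w \<xi>))
      \<le> expectation (\<lambda>\<xi>. - (2 * \<eta> / \<theta>) * (F (yhat k \<xi>) - F u)
        + 2 * \<eta> * ((1 - \<theta>) / \<theta>) * (F (w \<xi>) - F u))"
  proof (rule integral_mono)
    fix \<xi> assume "\<xi> \<in> space M"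
    from coupling_step_le[OF assms(2-5) yhat_eq[OF k this]]
    show "- 2 * \<eta> * (gradient F (yhat k \<xi>) \<bullet> (zhat k \<xi> - u))
        + \<eta>\<^sup>2 * b * variance_bound (yhat k \<xi>) (w \<xi>)
      \<le> - (2 * \<eta> / \<theta>) * (F (yhat k \<xi>) - F u) + 2 * \<eta> * ((1 - \<theta>) / \<theta>) * (F (w \<xi>) - F u)"
      unfolding variance_bound_def .
  qed (use i1 i2 i3 in simp_all)
  then show ?thesis using i1 i2 i3 by (simp add: prob_space)
qed

text \<open>Cross terms at step \<open>k\<close> involve second moments of earlier steps, which the
  progress of step \<open>k\<close> cannot absorb. Hence the steps are summed first, the delayed
  moments are regrouped by \<open>sum_delayed_le\<close>, and only then is the variance bound
  applied.\<close>

lemma epoch_le: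
  assumes \<theta>: "\<theta> > 0" and \<eta>: "\<eta> \<ge> 0"
    and \<eta>_eq: "\<eta> * b * L * \<theta> = 1 - \<theta>" and \<phi>_eq: "\<phi> * L = 1 - \<theta>"
    and b: "b \<ge> 1 + 2 * sqrt (max_overlap n T) * real \<tau>"
  shows "expectation (\<lambda>\<xi>. (norm (z m \<xi> - u))\<^sup>2)
      + 2 * \<eta> / \<theta> * (\<Sum>k<m. expectation (\<lambda>\<xi>. F (yhat k \<xi>)) - F u)
    \<le> expectation (\<lambda>\<xi>. (norm (z 0 \<xi> - u))\<^sup>2)
      + 2 * \<eta> * ((1 - \<theta>) / \<theta>) * real m * (expectation (\<lambda>\<xi>. F (w \<xi>)) - F u)"
proof -
  define \<Delta> where "\<Delta> = max_overlap n T"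
  define a where "a k = expectation (\<lambda>\<xi>. (norm (z k \<xi> - u))\<^sup>2)" for k
  define e where "e k = expectation (\<lambda>\<xi>. (norm (G k \<xi>))\<^sup>2)" for k
  define p where "p k = expectation (\<lambda>\<xi>. gradient F (yhat k \<xi>) \<bullet> (zhat k \<xi> - u))" for k
  define d where "d k = (\<Sum>j\<in>{k - \<tau>..<k}. e j + e k)" for k
  have \<Delta>: "\<Delta> > 0" unfolding \<Delta>_def by (rule max_overlap_pos)
  have "b \<ge> 0" by (rule order_trans[OF _ b]) (use \<Delta> in \<open>simp add: \<Delta>_def\<close>)
  have e: "e k \<ge> 0" for k by (simp add: e_def)
  have "a K \<le> a 0 + (\<Sum>k<K. - 2 * \<eta> * p k + \<eta>\<^sup>2 * sqrt \<Delta> * d k + \<eta>\<^sup>2 * e k)" if "K \<le> m" for K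
    using that
  proof (induction K)
    case (Suc K)
    then have "a (Suc K) \<le> a K - 2 * \<eta> * p K + \<eta>\<^sup>2 * sqrt \<Delta> * d K + \<eta>\<^sup>2 * e K"
      unfolding a_def p_def d_def e_def \<Delta>_def by (intro expectation_norm_z_Suc_le \<eta>) simp
    with Suc show ?case by simp
  qed simp
  from this[of m] have "a m \<le> a 0 + (\<Sum>k<m. - 2 * \<eta> * p k)
      + (\<eta>\<^sup>2 * sqrt \<Delta>) * (\<Sum>k<m. d k) + \<eta>\<^sup>2 * (\<Sum>k<m. e k)"
    by (simp add: sum.distrib sum_subtractf sum_negf sum_distrib_left)
  also have "(\<eta>\<^sup>2 * sqrt \<Delta>) * (\<Sum>k<m. d k) \<le> (\<eta>\<^sup>2 * sqrt \<Delta>) * (2 * real \<tau> * (\<Sum>k<m. e k))"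
    unfolding d_def using sum_delayed_le[OF e] \<Delta> by (intro mult_left_mono) auto
  also have "a 0 + (\<Sum>k<m. - 2 * \<eta> * p k) + (\<eta>\<^sup>2 * sqrt \<Delta>) * (2 * real \<tau> * (\<Sum>k<m. e k))
        + \<eta>\<^sup>2 * (\<Sum>k<m. e k)
      = a 0 + (\<Sum>k<m. - 2 * \<eta> * p k) + (1 + 2 * sqrt \<Delta> * real \<tau>) * (\<eta>\<^sup>2 * (\<Sum>k<m. e k))"
    by (simp add: algebra_simps)
  \<comment> \<open>From here on the factor is exactly \<open>b\<close>, the value for which
    \<open>\<eta>\<close> makes the coupling terms cancel.\<close>
  also have "(1 + 2 * sqrt \<Delta> * real \<tau>) * (\<eta>\<^sup>2 * (\<Sum>k<m. e k)) \<le> b * (\<eta>\<^sup>2 * (\<Sum>k<m. e k))"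
    using b e by (intro mult_right_mono) (auto simp: \<Delta>_def sum_nonneg)
  also have "a 0 + (\<Sum>k<m. - 2 * \<eta> * p k) + b * (\<eta>\<^sup>2 * (\<Sum>k<m. e k))
      = a 0 + (\<Sum>k<m. - 2 * \<eta> * p k + \<eta>\<^sup>2 * b * e k)"
    by (simp add: sum.distrib sum_subtractf sum_negf sum_distrib_left sum_distrib_right mult_ac)
  also have "(\<Sum>k<m. - 2 * \<eta> * p k + \<eta>\<^sup>2 * b * e k)
      \<le> (\<Sum>k<m. - (2 * \<eta> / \<theta>) * (expectation (\<lambda>\<xi>. F (yhat k \<xi>)) - F u)
        + 2 * \<eta> * ((1 - \<theta>) / \<theta>) * (expectation (\<lambda>\<xi>. F (w \<xi>)) - F u))"
  proof (rule sum_mono)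
    fix k assume "k \<in> {..<m}"
    then have k: "k < m" by simp
    have "- 2 * \<eta> * p k + \<eta>\<^sup>2 * b * e k
        \<le> - 2 * \<eta> * p k + \<eta>\<^sup>2 * b * expectation (\<lambda>\<xi>. variance_bound (yhat k \<xi>) (w \<xi>))"
      using expectation_norm_G_le[OF k] \<open>b \<ge> 0\<close> by (auto simp: e_def intro!: mult_left_mono)
    also note expectation_coupling_step_le[OF k \<theta> \<eta> \<eta>_eq \<phi>_eq, of u, folded p_def]
    finally show "- 2 * \<eta> * p k + \<eta>\<^sup>2 * b * e k
      \<le> - (2 * \<eta> / \<theta>) * (expectation (\<lambda>\<xi>. F (yhat k \<xi>)) - F u)
        + 2 * \<eta> * ((1 - \<theta>) / \<theta>) * (expectation (\<lambda>\<xi>. F (w \<xi>)) - F u)" .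
  qed
  also have "\<dots> = - (2 * \<eta> / \<theta>) * (\<Sum>k<m. expectation (\<lambda>\<xi>. F (yhat k \<xi>)) - F u)
      + 2 * \<eta> * ((1 - \<theta>) / \<theta>) * real m * (expectation (\<lambda>\<xi>. F (w \<xi>)) - F u)"
    by (simp only: sum.distrib sum_distrib_left[symmetric] sum_constant card_lessThan mult_ac)
  finally show ?thesis by (simp add: a_def)
qed

end

section \<open>One round\<close>

locale convex_run =
  AS_Acc_SVRG M f n T m \<tau> \<theta> \<phi> \<eta> S R x0 \<F> idx pick J zhat yhat G z xt x + sparse_convex_sum f n T L
  for M :: "'w measure" and f :: "nat \<Rightarrow> real ^ 'd::finite \<Rightarrow> real" and n T m \<tau> \<theta> \<phi> \<eta> S R x0 \<F> idx
    pick J zhat yhat G z xt x L +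
  assumes S_pos: "S > 0" and m_pos: "m > 0"
begin

text \<open>The induction invariant along the run: what \<open>async_epoch\<close> requires of the
  state at the start of an epoch beyond the model itself.\<close>

definition ready :: "nat \<Rightarrow> nat \<Rightarrow> bool" where
  "ready r s \<longleftrightarrow> xt r s \<in> borel_measurable (\<F> r s 0) \<and> sq_integrable M (xt r s)
     \<and> sq_integrable M (z r s 0)"

lemma epoch:
  assumes "r < R" "s < S" "ready r s"
  shows "async_epoch M f n T L m \<tau> \<theta> \<phi> \<eta> (\<F> r s) (idx r s) (J r s) (zhat r s) (yhat r s) (G r s)
    (z r s) (xt r s)"
proof -
  note rs = assms(1,2)
  have "xt r s \<in> borel_measurable (\<F> r s 0)" "sq_integrable M (xt r s)" "sq_integrable M (z r s 0)"
    using assms(3) by (simp_all add: ready_def)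
  note rules = this yhat_eq[OF rs] G_eq[OF rs, folded est_def] z_Suc[OF rs] J_zero_one[OF rs]
    zhat_eq[OF rs] \<F>_subalgebra[OF rs] \<F>_update[OF rs] zhat_measurable[OF rs]
    idx_measurable[OF rs] idx_uniform[OF rs] idx_indep[OF rs]
  show ?thesis
    by unfold_locales (rule rules; assumption)+
qed

text \<open>\<open>N\<close> stands for any stage at which the pick is known: the whole space, the
  start of the next epoch, or the start of the next round.\<close>

lemma snapshot_measurable:
  assumes r: "r < R" "s < S" "ready r s" and N: "subalgebra N (\<F> r s m)"
    and pick: "pick r s \<in> N \<rightarrow>\<^sub>M count_space {..<m}"
  shows "xt r (Suc s) \<in> borel_measurable N"
proof -
  interpret e: async_epoch M f n T L m \<tau> \<theta> \<phi> \<eta> "\<F> r s" "idx r s" "J r s" "zhat r s" "yhat r s" "G r s"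
    "z r s" "xt r s"
    by (rule epoch[OF r])
  have "space N = space M" using N e.space_A[of m] by (simp add: subalgebra_def)
  moreover have "(\<lambda>\<xi>. yhat r s (pick r s \<xi>) \<xi>) \<in> borel_measurable N"
  proof (rule measurable_compose_countable'[OF _ pick])
    fix k assume "k \<in> {..<m}"
    then show "yhat r s k \<in> borel_measurable N"
      using measurable_from_subalg[OF N measurable_from_subalg[OF e.A_mono e.yhat_measurable]] by simp
  qed simp
  ultimately show ?thesis
    using snapshot[OF r(1,2)] by (subst measurable_cong) auto
qed

lemma sq_integrable_snapshot:
  assumes r: "r < R" "s < S" "ready r s"
  shows "sq_integrable M (xt r (Suc s))"
proof -
  interpret e: async_epoch M f n T L m \<tau> \<theta> \<phi> \<eta> "\<F> r s" "idx r s" "J r s" "zhat r s" "yhat r s" "G r s"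
    "z r s" "xt r s"
    by (rule epoch[OF r])
  have "sq_integrable M (\<lambda>\<xi>. \<Sum>k<m. norm (yhat r s k \<xi>))"
    by (rule sq_integrable_sum) (simp_all add: sq_integrable_norm e.sq_integrable_yhat')
  moreover have "xt r (Suc s) \<in> borel_measurable M"
    by (rule snapshot_measurable[OF r \<F>_subalgebra pick_measurable]) (use r in simp_all)
  moreover have "norm (xt r (Suc s) \<xi>) \<le> norm (\<Sum>k<m. norm (yhat r s k \<xi>))" if \<xi>: "\<xi> \<in> space M" for \<xi>
  proof -
    have "pick r s \<xi> \<in> {..<m}"
      using measurable_space[OF pick_measurable[OF r(1,2)] \<xi>] by simp
    then have "norm (yhat r s (pick r s \<xi>) \<xi>) \<le> (\<Sum>k<m. norm (yhat r s k \<xi>))"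
      by (intro member_le_sum) auto
    then show ?thesis
      using snapshot[OF r(1,2) \<xi>] by (simp add: abs_of_nonneg sum_nonneg)
  qed
  ultimately show ?thesis by (rule sq_integrable_dominated)
qed

text \<open>All points of the epoch are measurable at its end, and the pick is uniform and
  independent of that information.\<close>

lemma expectation_snapshot:
  assumes r: "r < R" "s < S" "ready r s"
  shows "expectation (\<lambda>\<xi>. F (xt r (Suc s) \<xi>)) = (1 / real m) * (\<Sum>k<m. expectation (\<lambda>\<xi>. F (yhat r s k \<xi>)))"
proof -
  interpret e: async_epoch M f n T L m \<tau> \<theta> \<phi> \<eta> "\<F> r s" "idx r s" "J r s" "zhat r s" "yhat r s" "G r s"
    "z r s" "xt r s"
    by (rule epoch[OF r])
  have "expectation (\<lambda>\<xi>. F (xt r (Suc s) \<xi>)) = expectation (\<lambda>\<xi>. F (yhat r s (pick r s \<xi>) \<xi>))"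
    by (rule Bochner_Integration.integral_cong) (simp_all add: snapshot r)
  also have "\<dots> = (1 / real (card {..<m})) * (\<Sum>k<m. expectation (\<lambda>\<xi>. F (yhat r s k \<xi>)))"
  proof (rule expectation_uniform_index(2)[OF _ _ pick_measurable[OF r(1,2)] pick_uniform[OF r(1,2)]
        pick_indep[OF r(1,2)] \<F>_subalgebra[OF r(1,2)], where h = "\<lambda>k \<xi>. F (yhat r s k \<xi>)"])
    fix k assume "k \<in> {..<m}"
    then have k: "k < m" by simp
    have "yhat r s k \<in> borel_measurable (\<F> r s m)"
      by (rule measurable_from_subalg[OF e.A_mono e.yhat_measurable]) (use k in simp_all)
    then show "(\<lambda>\<xi>. F (yhat r s k \<xi>)) \<in> borel_measurable (\<F> r s m)"
      using measurable_compose[OF _ measurable_F] by blast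
    show "integrable M (\<lambda>\<xi>. F (yhat r s k \<xi>))"
      by (rule e.integrable_F'[OF e.sq_integrable_yhat'[OF k]])
  qed (use m_pos in auto)
  finally show ?thesis by simp
qed

lemma ready_Suc:
  assumes r: "r < R" and s: "Suc s < S" and "ready r s"
  shows "ready r (Suc s)"
proof -
  have s': "s < S" using s by simp
  interpret e: async_epoch M f n T L m \<tau> \<theta> \<phi> \<eta> "\<F> r s" "idx r s" "J r s" "zhat r s" "yhat r s" "G r s"
    "z r s" "xt r s"
    by (rule epoch[OF r s' assms(3)])
  have "sq_integrable M (z r (Suc s) 0)"
    using e.sq_integrable_z[of m] by (subst sq_integrable_cong[OF z_next_epoch[OF r s]]) simp_all
  then show ?thesis
    unfolding ready_def
    using sq_integrable_snapshot[OF r s' assms(3)]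
      snapshot_measurable[OF r s' assms(3) \<F>_epoch[OF r s] pick_measurable_epoch[OF r s]]
    by simp
qed

lemma ready_round:
  assumes "r < R" "ready r 0" "s < S"
  shows "ready r s"
  using assms(3) by (induction s) (auto intro: ready_Suc assms)

lemma sq_integrable_x_Suc:
  assumes r: "r < R" "ready r 0"
  shows "sq_integrable M (x (Suc r))"
proof (subst sq_integrable_cong[OF x_Suc[OF r(1)]])
  show "sq_integrable M (\<lambda>\<xi>. (1 / real S) *\<^sub>R (\<Sum>s<S. xt r (Suc s) \<xi>))"
    by (intro sq_integrable_scaleR sq_integrable_sum)
      (auto intro: sq_integrable_snapshot ready_round r)
qed

text \<open>Keeps the snapshots of early epochs measurable until the next round starts, where all of
  them are averaged.\<close>

lemma \<F>_end_of_round: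
  assumes r: "r < R" and s: "s < S"
  shows "subalgebra (\<F> r (S - 1) m) (\<F> r s 0)"
proof -
  have within: "subalgebra (\<F> r s k) (\<F> r s 0)" if "s < S" "k \<le> m" for s k
    using that(2)
  proof (induction k)
    case 0
    show ?case by (simp add: subalgebra_def)
  next
    case (Suc k)
    then show ?case using \<F>_update[OF r that(1), of k] by (auto simp: subalgebra_def)
  qed
  have "s \<le> S - 1" using s by simp
  then show ?thesis
  proof (induction s rule: inc_induct)
    case base
    show ?case using within[of "S - 1" m] S_pos by simp
  next
    case (step k)
    then have "subalgebra (\<F> r (Suc k) 0) (\<F> r k m)" "subalgebra (\<F> r k m) (\<F> r k 0)"
      using \<F>_epoch[OF r, of k] within[of k m] by auto
    with step.IH show ?case by (auto simp: subalgebra_def)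
  qed
qed

lemma ready_next_round:
  assumes r: "Suc r < R" and ready: "ready r 0"
  shows "ready (Suc r) 0"
proof -
  have r': "r < R" using r by simp
  \<comment> \<open>Every snapshot but the last is already known when a later epoch of the round
    starts. The last one becomes known only at the start of the next round, through its
    pick.\<close>
  have meas: "xt r (Suc s) \<in> borel_measurable (\<F> (Suc r) 0 0)" if s: "s < S" for s
  proof (cases "Suc s < S")
    case True
    then have "xt r (Suc s) \<in> borel_measurable (\<F> r (Suc s) 0)"
      using ready_round[OF r' ready] by (simp add: ready_def)
    then show ?thesis
      using measurable_from_subalg[OF \<F>_round[OF r] measurable_from_subalg[OF \<F>_end_of_round[OF r' True]]]
      by blast
  next
    case False
    then have "s = S - 1" using s by simp
    then show ?thesis
      using snapshot_measurable[OF r' s ready_round[OF r' ready s]] \<F>_round[OF r] pick_measurable_round[OF r]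
      by simp
  qed
  have space: "space (\<F> (Suc r) 0 0) = space M"
    using \<F>_subalgebra[OF r S_pos, of 0] by (simp add: subalgebra_def)
  have start: "xt (Suc r) 0 \<xi> = x (Suc r) \<xi>" "z (Suc r) 0 0 \<xi> = x (Suc r) \<xi>" if "\<xi> \<in> space M" for \<xi>
    using round_start[OF r that] by auto
  have "(\<lambda>\<xi>. (1 / real S) *\<^sub>R (\<Sum>s<S. xt r (Suc s) \<xi>)) \<in> borel_measurable (\<F> (Suc r) 0 0)"
    using meas by (intro borel_measurable_scaleR borel_measurable_sum) auto
  then have "xt (Suc r) 0 \<in> borel_measurable (\<F> (Suc r) 0 0)"
    by (subst measurable_cong[where g = "\<lambda>\<xi>. (1 / real S) *\<^sub>R (\<Sum>s<S. xt r (Suc s) \<xi>)"])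
      (simp_all add: space start x_Suc[OF r'])
  then show ?thesis
    unfolding ready_def
    using sq_integrable_x_Suc[OF r' ready] sq_integrable_cong[of M, OF start(1)]
      sq_integrable_cong[of M, OF start(2)]
    by simp
qed

lemma ready_0:
  assumes "0 < R"
  shows "ready 0 0"
proof -
  have start: "xt 0 0 \<xi> = x0" "z 0 0 0 \<xi> = x0" if "\<xi> \<in> space M" for \<xi>
    using round_start[OF assms that] x_0[OF that] by auto
  have space: "space (\<F> 0 0 0) = space M"
    using \<F>_subalgebra[OF assms S_pos, of 0] by (simp add: subalgebra_def)
  have "xt 0 0 \<in> borel_measurable (\<F> 0 0 0)"
    by (subst measurable_cong[where g = "\<lambda>_. x0"]) (simp_all add: space start)
  then show ?thesis
    unfolding ready_def
    using sq_integrable_cong[of M, OF start(1)] sq_integrable_cong[of M, OF start(2)] sq_integrable_const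
    by simp
qed

lemma ready_start: "r < R \<Longrightarrow> ready r 0"
  by (induction r) (auto intro: ready_0 ready_next_round)

lemma sq_integrable_x:
  assumes "r \<le> R"
  shows "sq_integrable M (x r)"
proof (cases r)
  case 0
  then show ?thesis using sq_integrable_cong[of M "x 0", OF x_0] sq_integrable_const by simp
next
  case (Suc k)
  then show ?thesis using assms by (simp add: sq_integrable_x_Suc ready_start)
qed

text \<open>Jensen's inequality via the tangent at the average, where the first-order terms sum to
  zero.\<close>

lemma F_average_le: "F ((1 / real S) *\<^sub>R (\<Sum>s<S. y s)) \<le> (1 / real S) * (\<Sum>s<S. F (y s))"
proof -
  define c where "c = (1 / real S) *\<^sub>R (\<Sum>s<S. y s)"
  have "real S *\<^sub>R c = (\<Sum>s<S. y s)"
    using S_pos by (simp add: c_def)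
  then have "(\<Sum>s<S. y s - c) = 0"
    by (simp add: sum_subtractf sum_constant_scaleR del: sum_constant)
  then have "real S * F c = (\<Sum>s<S. F c + gradient F c \<bullet> (y s - c))"
    by (simp add: sum.distrib inner_sum_right[symmetric])
  also have "\<dots> \<le> (\<Sum>s<S. F (y s))"
    by (intro sum_mono F_lower_bound)
  finally show ?thesis using S_pos by (simp add: c_def field_simps)
qed

text \<open>Leaving \<open>z\<close> unchanged between epochs lets the distance terms telescope.
  Resetting both \<open>z\<close> and the snapshot to \<open>x r\<close> at the start of the round
  bounds all that remains by a single initial gap.\<close>

lemma round_contraction:
  assumes r: "r < R"
    and \<theta>: "0 < \<theta>" "\<theta> \<le> 1" and \<eta>: "\<eta> > 0"
    and \<eta>_eq: "\<eta> * b * L * \<theta> = 1 - \<theta>" and \<phi>_eq: "\<phi> * L = 1 - \<theta>"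
    and b: "b \<ge> 1 + 2 * sqrt (max_overlap n T) * real \<tau>"
    and \<mu>: "\<mu> > 0" and growth: "\<And>y. F y - F u \<ge> \<mu> / 2 * (norm (y - u))\<^sup>2"
  shows "expectation (\<lambda>\<xi>. F (x (Suc r) \<xi>)) - F u
    \<le> (1 / real S) * ((1 - \<theta>) / \<theta> + 1 / (\<eta> * real m * \<mu>)) * (expectation (\<lambda>\<xi>. F (x r \<xi>)) - F u)"
proof -
  define q where "q = (1 - \<theta>) / \<theta>"
  define D where "D s = expectation (\<lambda>\<xi>. F (xt r s \<xi>)) - F u" for s
  define a where "a s = expectation (\<lambda>\<xi>. (norm (z r s 0 \<xi> - u))\<^sup>2)" for s
  \<comment> \<open>Kept apart from \<open>a\<close> because after the last epoch there is no next
    start to identify it with.\<close>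
  define c where "c s = expectation (\<lambda>\<xi>. (norm (z r s m \<xi> - u))\<^sup>2)" for s
  define h where "h = 2 * \<eta> * real m"
  have h: "h > 0" using \<eta> m_pos by (simp add: h_def)
  have q: "q \<ge> 0" using \<theta> by (simp add: q_def)
  have ready: "ready r s" if "s < S" for s
    by (rule ready_round[OF r ready_start[OF r] that])
  have F_int: "integrable M (\<lambda>\<xi>. F (X \<xi>))" if "sq_integrable M X" for X
    by (rule integrable_F[OF finite_measure_axioms that])
  have epoch_bound: "c s + h * (1 + q) * D (Suc s) \<le> a s + h * q * D s" if s: "s < S" for s
  proof -
    interpret e: async_epoch M f n T L m \<tau> \<theta> \<phi> \<eta> "\<F> r s" "idx r s" "J r s" "zhat r s" "yhat r s" "G r s"
      "z r s" "xt r s"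
      by (rule epoch[OF r s ready[OF s]])
    have "(\<Sum>k<m. expectation (\<lambda>\<xi>. F (yhat r s k \<xi>)) - F u) = real m * D (Suc s)"
      using m_pos by (simp add: D_def expectation_snapshot[OF r s ready[OF s]] sum_subtractf field_simps)
    moreover have "1 / \<theta> = 1 + q" using \<theta> by (simp add: q_def field_simps)
    then have "2 * \<eta> / \<theta> * (real m * D (Suc s)) = h * (1 + q) * D (Suc s)"
      unfolding h_def by (metis (no_types, opaque_lifting) mult.assoc mult.commute times_divide_eq_right mult.right_neutral)
    ultimately show ?thesis
      using e.epoch_le[OF \<theta>(1) less_imp_le[OF \<eta>] \<eta>_eq \<phi>_eq b, of u]
      by (simp add: a_def c_def D_def q_def h_def mult_ac)
  qed
  have c_eq: "a (Suc s) = c s" if "Suc s < S" for s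
    unfolding a_def c_def by (rule Bochner_Integration.integral_cong) (simp_all add: z_next_epoch[OF r that])
  \<comment> \<open>Of the weight \<open>h * (1 + q)\<close> on a new snapshot, the part
    \<open>h * q\<close> pays for its use in the next epoch and the part \<open>h\<close> is
    collected.\<close>
  have "h * (\<Sum>i\<le>s. D (Suc i)) + h * q * D (Suc s) + c s \<le> a 0 + h * q * D 0" if "s < S" for s
    using that
  proof (induction s)
    case 0
    then show ?case using epoch_bound[of 0] by (simp add: algebra_simps)
  next
    case (Suc s)
    then show ?case using epoch_bound[of "Suc s"] c_eq[of s] by (simp add: algebra_simps)
  qed
  from this[of "S - 1"] have "h * (\<Sum>s<S. D (Suc s)) + h * q * D S + c (S - 1) \<le> a 0 + h * q * D 0"
    using S_pos by (simp add: lessThan_Suc_atMost[symmetric])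
  moreover have "D S \<ge> 0"
  proof -
    have "F u \<le> F y" for y
      by (rule order_trans[of _ "F u + \<mu> / 2 * (norm (y - u))\<^sup>2"]) (use \<mu> growth[of y] in auto)
    moreover have "integrable M (\<lambda>\<xi>. F (xt r S \<xi>))"
      using F_int[OF sq_integrable_snapshot[OF r _ ready], of "S - 1"] S_pos by simp
    ultimately have "expectation (\<lambda>\<xi>. F u) \<le> expectation (\<lambda>\<xi>. F (xt r S \<xi>))"
      by (intro integral_mono) auto
    then show ?thesis by (simp add: D_def prob_space)
  qed
  moreover have "c (S - 1) \<ge> 0" by (simp add: c_def)
  \<comment> \<open>Quadratic growth is needed as a distance bound only here, at the common starting
    point of the round.\<close>
  moreover have "a 0 \<le> (2 / \<mu>) * D 0"
  proof -
    have sq: "sq_integrable M (x r)" using sq_integrable_x r by simp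
    have "a 0 = expectation (\<lambda>\<xi>. (norm (x r \<xi> - u))\<^sup>2)"
      unfolding a_def by (rule Bochner_Integration.integral_cong) (simp_all add: round_start[OF r])
    also have "\<dots> \<le> expectation (\<lambda>\<xi>. (2 / \<mu>) * (F (x r \<xi>) - F u))"
    proof (rule integral_mono)
      show "integrable M (\<lambda>\<xi>. (norm (x r \<xi> - u))\<^sup>2)"
        using sq_integrable_diff[OF sq sq_integrable_const[of u]] by (simp add: sq_integrable_def)
      show "integrable M (\<lambda>\<xi>. (2 / \<mu>) * (F (x r \<xi>) - F u))"
        using F_int[OF sq] by simp
      show "(norm (x r \<xi> - u))\<^sup>2 \<le> (2 / \<mu>) * (F (x r \<xi>) - F u)" for \<xi>
        using growth[of "x r \<xi>"] \<mu> by (simp add: field_simps)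
    qed
    also have "\<dots> = (2 / \<mu>) * D 0"
    proof -
      have "expectation (\<lambda>\<xi>. F (xt r 0 \<xi>)) = expectation (\<lambda>\<xi>. F (x r \<xi>))"
        by (rule Bochner_Integration.integral_cong) (simp_all add: round_start[OF r])
      then show ?thesis using F_int[OF sq] by (simp add: D_def prob_space)
    qed
    finally show ?thesis .
  qed
  ultimately have "h * (\<Sum>s<S. D (Suc s)) \<le> (2 / \<mu> + h * q) * D 0"
    using h q by (simp add: distrib_right) (smt (verit) mult_nonneg_nonneg)
  also have "2 / \<mu> + h * q = h * (q + 1 / (\<eta> * real m * \<mu>))"
    using \<eta> m_pos \<mu> by (simp add: h_def field_simps)
  finally have sum_le: "(\<Sum>s<S. D (Suc s)) \<le> (q + 1 / (\<eta> * real m * \<mu>)) * D 0"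
    using h by (simp add: mult.assoc)
  have snap_int: "integrable M (\<lambda>\<xi>. F (xt r (Suc s) \<xi>))" if "s < S" for s
    by (rule F_int[OF sq_integrable_snapshot[OF r that ready[OF that]]])
  have "expectation (\<lambda>\<xi>. F (x (Suc r) \<xi>)) \<le> expectation (\<lambda>\<xi>. (1 / real S) * (\<Sum>s<S. F (xt r (Suc s) \<xi>)))"
    by (rule integral_mono)
      (use F_int[OF sq_integrable_x[of "Suc r"]] r snap_int F_average_le in
        \<open>auto simp: x_Suc[OF r] intro!: Bochner_Integration.integrable_sum integrable_divide\<close>)
  also have "\<dots> = (1 / real S) * (\<Sum>s<S. expectation (\<lambda>\<xi>. F (xt r (Suc s) \<xi>)))"
    using Bochner_Integration.integral_sum[of "{..<S}" M "\<lambda>s \<xi>. F (xt r (Suc s) \<xi>)"] snap_int by simp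
  also have "\<dots> = (1 / real S) * (\<Sum>s<S. D (Suc s)) + F u"
    using S_pos by (simp add: D_def sum_subtractf field_simps)
  finally have "expectation (\<lambda>\<xi>. F (x (Suc r) \<xi>)) - F u \<le> (1 / real S) * (\<Sum>s<S. D (Suc s))"
    by simp
  also have "\<dots> \<le> (1 / real S) * ((q + 1 / (\<eta> * real m * \<mu>)) * D 0)"
    using sum_le by (intro mult_left_mono) auto
  also have "D 0 = expectation (\<lambda>\<xi>. F (x r \<xi>)) - F u"
    unfolding D_def
    by (rule arg_cong[where f = "\<lambda>t. t - F u"], rule Bochner_Integration.integral_cong)
      (simp_all add: round_start[OF r])
  finally show ?thesis by (simp add: q_def mult.assoc)
qed

end

section \<open>Restarts and the choice of the parameters\<close>

context convex_run
begin

lemma restart_bound: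
  assumes \<theta>: "0 < \<theta>" "\<theta> \<le> 1" and \<eta>: "\<eta> > 0"
    and \<eta>_eq: "\<eta> * b * L * \<theta> = 1 - \<theta>" and \<phi>_eq: "\<phi> * L = 1 - \<theta>"
    and b: "b \<ge> 1 + 2 * sqrt (max_overlap n T) * real \<tau>"
    and \<mu>: "\<mu> > 0" and growth: "\<And>y. F y - F u \<ge> \<mu> / 2 * (norm (y - u))\<^sup>2"
    and rate: "(1 / real S) * ((1 - \<theta>) / \<theta> + 1 / (\<eta> * real m * \<mu>)) \<le> \<rho>"
    and r: "r \<le> R"
  shows "expectation (\<lambda>\<xi>. F (x r \<xi>)) - F u \<le> \<rho> ^ r * (F x0 - F u)"
  using r
proof (induction r)
  case 0
  have "expectation (\<lambda>\<xi>. F (x 0 \<xi>)) = expectation (\<lambda>\<xi>. F x0)"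
    by (rule Bochner_Integration.integral_cong) (simp_all add: x_0)
  then show ?case by (simp add: prob_space)
next
  case (Suc r)
  have "(1 / real S) * ((1 - \<theta>) / \<theta> + 1 / (\<eta> * real m * \<mu>)) \<ge> 0"
    using \<theta> \<eta> \<mu> by simp
  with rate have \<rho>: "\<rho> \<ge> 0" by linarith
  \<comment> \<open>Minimality makes the expected gap nonnegative, which allows its factor to be
    enlarged to \<open>\<rho>\<close>.\<close>
  have "F u \<le> F y" for y
    by (rule order_trans[of _ "F u + \<mu> / 2 * (norm (y - u))\<^sup>2"]) (use \<mu> growth[of y] in auto)
  moreover have "integrable M (\<lambda>\<xi>. F (x r \<xi>))"
    by (rule integrable_F[OF finite_measure_axioms sq_integrable_x]) (use Suc.prems in simp)
  ultimately have "expectation (\<lambda>\<xi>. F u) \<le> expectation (\<lambda>\<xi>. F (x r \<xi>))"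
    by (intro integral_mono) auto
  then have gap: "expectation (\<lambda>\<xi>. F (x r \<xi>)) - F u \<ge> 0" by (simp add: prob_space)
  have "expectation (\<lambda>\<xi>. F (x (Suc r) \<xi>)) - F u
      \<le> (1 / real S) * ((1 - \<theta>) / \<theta> + 1 / (\<eta> * real m * \<mu>)) * (expectation (\<lambda>\<xi>. F (x r \<xi>)) - F u)"
    by (rule round_contraction[OF _ \<theta> \<eta> \<eta>_eq \<phi>_eq b \<mu> growth]) (use Suc.prems in simp)
  also have "\<dots> \<le> \<rho> * (expectation (\<lambda>\<xi>. F (x r \<xi>)) - F u)"
    by (rule mult_right_mono[OF rate gap])
  also have "\<dots> \<le> \<rho> * (\<rho> ^ r * (F x0 - F u))"
    by (rule mult_left_mono[OF Suc.IH \<rho>]) (use Suc.prems in simp)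
  finally show ?case by (simp add: mult.assoc)
qed

end

lemma epochs_bound:
  fixes \<kappa> b C c\<^sub>1 \<omega> :: real and n m :: nat
  assumes "\<kappa> > 0" "C \<ge> 0" "c\<^sub>1 > 0" "n > 0" "c\<^sub>1 * real n \<le> real m" "\<omega> > 0"
    and b: "0 \<le> b" "b \<le> 1 + 2 * (C * max (real n / \<kappa>) 1)"
  shows "real (nat \<lceil>2 * \<omega> * sqrt (\<kappa> / real m * b)\<rceil>) \<le> epochs_const \<omega> c\<^sub>1 C * max 1 (sqrt (\<kappa> / real n))"
proof -
  define M where "M = max 1 (\<kappa> / real n)"
  have n: "real n > 0" using \<open>n > 0\<close> by simp
  have cn: "c\<^sub>1 * real n > 0" using \<open>c\<^sub>1 > 0\<close> n by simp
  then have m: "real m > 0" using assms(5) by linarith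
  have "\<kappa> / real m * b \<le> \<kappa> / (c\<^sub>1 * real n) * (1 + 2 * (C * max (real n / \<kappa>) 1))"
    using assms cn m by (intro mult_mono divide_left_mono) auto
  also have "\<dots> = (\<kappa> / real n + 2 * C * (\<kappa> / real n * max (real n / \<kappa>) 1)) / c\<^sub>1"
    using n \<open>c\<^sub>1 > 0\<close> by (simp add: field_simps)
  \<comment> \<open>The admissible growth of \<open>b\<close> is tuned to this identity: asynchrony
    alters the constant but not the order \<open>max 1 (\<kappa> / real n)\<close>.\<close>
  also have "\<kappa> / real n * max (real n / \<kappa>) 1 = M"
    using n \<open>\<kappa> > 0\<close> by (auto simp: M_def max_def field_simps)
  also have "(\<kappa> / real n + 2 * C * M) / c\<^sub>1 \<le> (M + 2 * C * M) / c\<^sub>1"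
    using \<open>c\<^sub>1 > 0\<close> by (intro divide_right_mono add_right_mono) (auto simp: M_def)
  also have "\<dots> = (1 + 2 * C) / c\<^sub>1 * M"
    by (simp add: field_simps)
  finally have "sqrt (\<kappa> / real m * b) \<le> sqrt ((1 + 2 * C) / c\<^sub>1) * sqrt M"
    by (metis real_sqrt_le_mono real_sqrt_mult)
  also have sqrt_M: "sqrt M = max 1 (sqrt (\<kappa> / real n))"
    by (auto simp: M_def max_def)
  finally have "2 * \<omega> * sqrt (\<kappa> / real m * b)
      \<le> 2 * \<omega> * (sqrt ((1 + 2 * C) / c\<^sub>1) * max 1 (sqrt (\<kappa> / real n)))"
    using \<open>\<omega> > 0\<close> by (intro mult_left_mono) auto
  moreover have "2 * \<omega> * sqrt (\<kappa> / real m * b) \<ge> 0"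
    using assms by simp
  \<comment> \<open>Rounding up costs at most 1, which the outer maximum absorbs; this is the 1 in
    \<open>epochs_const\<close>.\<close>
  then have "real (nat \<lceil>2 * \<omega> * sqrt (\<kappa> / real m * b)\<rceil>) \<le> 1 + 2 * \<omega> * sqrt (\<kappa> / real m * b)"
    by linarith
  ultimately have "real (nat \<lceil>2 * \<omega> * sqrt (\<kappa> / real m * b)\<rceil>)
      \<le> 1 + 2 * \<omega> * sqrt ((1 + 2 * C) / c\<^sub>1) * max 1 (sqrt (\<kappa> / real n))"
    by (simp add: mult.assoc)
  also have "\<dots> \<le> max 1 (sqrt (\<kappa> / real n)) + 2 * \<omega> * sqrt ((1 + 2 * C) / c\<^sub>1) * max 1 (sqrt (\<kappa> / real n))"
    by simp
  finally show ?thesis by (simp add: epochs_const_def distrib_right)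
qed

lemma oracle_bound:
  fixes n m R S :: nat
  assumes "n > 0" "\<kappa> > 0"
    and "real R \<le> a * l" "real S \<le> e * max 1 (sqrt (\<kappa> / real n))" "real m \<le> c * real n"
  shows "real (R * S * (n + 2 * m)) \<le> a * e * (1 + 2 * c) * (max (real n) (sqrt (\<kappa> * real n)) * l)"
proof -
  have n: "real n * max 1 (sqrt (\<kappa> / real n)) = max (real n) (sqrt (\<kappa> * real n))"
  proof -
    have "real n * sqrt (\<kappa> / real n) = sqrt (\<kappa> * real n)"
      using assms(1,2) by (simp add: real_sqrt_divide real_sqrt_mult field_simps)
    then show ?thesis by (simp add: max_mult_distrib_left)
  qed
  have "real (R * S * (n + 2 * m)) = real R * real S * (real n + 2 * real m)" by simp
  also have "\<dots> \<le> (a * l) * (e * max 1 (sqrt (\<kappa> / real n))) * ((1 + 2 * c) * real n)"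
  proof (intro mult_mono)
    show "real n + 2 * real m \<le> (1 + 2 * c) * real n" using assms(5) by (simp add: algebra_simps)
    show "0 \<le> a * l" using assms(3) by (rule order_trans[rotated]) simp
    then show "0 \<le> a * l * (e * max 1 (sqrt (\<kappa> / real n)))"
      using order_trans[OF of_nat_0_le_iff assms(4)] by (rule mult_nonneg_nonneg)
  qed (use assms in auto)
  also have "\<dots> = a * e * (1 + 2 * c) * ((real n * max 1 (sqrt (\<kappa> / real n))) * l)"
    by (simp only: mult_ac)
  finally show ?thesis unfolding n .
qed

text \<open>For \<open>g > \<epsilon>\<close> the choice is
  \<open>ln (g / \<epsilon>) / ln \<omega>\<close> rounded up: in \<open>rounds_const\<close> the 1
  pays for rounding and \<open>1 / ln \<omega>\<close> for the change of base. A gap of at most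
  \<open>\<epsilon>\<close>, in particular \<open>g = 0\<close>, takes no round at all.\<close>

lemma restart_number:
  fixes g \<epsilon> \<omega> :: real
  assumes "\<omega> > 1" "\<epsilon> > 0"
  obtains R :: nat where "real R \<le> rounds_const \<omega> * max 1 (ln (g / \<epsilon>))" "(1 / \<omega>) ^ R * g \<le> \<epsilon>"
proof (cases "g \<le> \<epsilon>")
  case True
  have "rounds_const \<omega> \<ge> 0" using assms(1) by (simp add: rounds_const_def)
  then show ?thesis using that[of 0] True by simp
next
  case False
  then have g: "g > \<epsilon>" by simp
  define t where "t = ln (g / \<epsilon>) / ln \<omega>"
  define R where "R = nat \<lceil>t\<rceil>"
  have l: "ln \<omega> > 0" using assms(1) by simp
  have t: "t \<ge> 0" unfolding t_def using g assms l by simp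
  have R: "t \<le> real R" "real R \<le> 1 + t" unfolding R_def using t by linarith+
  have "1 + t \<le> max 1 (ln (g / \<epsilon>)) + max 1 (ln (g / \<epsilon>)) / ln \<omega>"
    unfolding t_def using l by (intro add_mono divide_right_mono) auto
  then have "real R \<le> rounds_const \<omega> * max 1 (ln (g / \<epsilon>))"
    using R(2) by (simp add: rounds_const_def algebra_simps)
  moreover have "(1 / \<omega>) ^ R * g \<le> \<epsilon>"
  proof -
    have "ln (g / \<epsilon>) = t * ln \<omega>" using l by (simp add: t_def)
    also have "\<dots> \<le> real R * ln \<omega>" using R(1) l by (intro mult_right_mono) auto
    also have "\<dots> = ln (\<omega> ^ R)" using assms(1) by (simp add: ln_realpow)
    finally have "g / \<epsilon> \<le> \<omega> ^ R"
      using g assms by (subst (asm) ln_le_cancel_iff) auto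
    then show ?thesis using assms by (simp add: power_one_over field_simps)
  qed
  ultimately show ?thesis by (rule that)
qed

text \<open>Integrability is part of the conclusion because the integral bound alone would say
  little if the integral were 0 by convention.\<close>

theorem corollary2p1:
  fixes f :: "nat \<Rightarrow> real ^ 'd::finite \<Rightarrow> real"
    and n m \<tau> S :: nat
    and T :: "nat \<Rightarrow> 'd set"
    and xstar :: "real ^ 'd"
    and L \<mu> \<kappa> \<Delta> \<omega> c\<^sub>1 c\<^sub>2 C \<tau>t \<theta> \<phi> \<eta> :: real
  assumes cover: "\<And>v. \<exists>i\<in>{1..n}. v \<in> T i"
    and convex: "\<And>i. i \<in> {1..n} \<Longrightarrow> convex_on UNIV (f i)"
    and smooth: "\<And>i. i \<in> {1..n} \<Longrightarrow> L_smooth L (f i)"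
    and supp: "\<And>i. i \<in> {1..n} \<Longrightarrow> supported_on (T i) (f i)"
    and L_pos: "L > 0" and \<mu>_pos: "\<mu> > 0"
    and growth: "\<And>x. mean_fun n f x - mean_fun n f xstar \<ge> \<mu> / 2 * (norm (x - xstar))\<^sup>2"
    and \<kappa>_eq: "\<kappa> = L / \<mu>"
    and \<Delta>_eq: "\<Delta> = max_overlap n T"
    and \<omega>_gt: "\<omega> > 1"
    and m_Theta: "c\<^sub>1 > 0" "c\<^sub>1 * real n \<le> real m" "real m \<le> c\<^sub>2 * real n"
    and \<tau>t_ge: "real \<tau> \<le> \<tau>t"
    and \<tau>t_O: "\<tau>t \<le> C * (1 / sqrt \<Delta> * max (real n / \<kappa>) 1)"
    and \<theta>_eq: "\<theta> = sqrt (real m) / (sqrt (\<kappa> * (1 + 2 * sqrt \<Delta> * \<tau>t)) + sqrt (real m))"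
    and \<phi>_eq: "\<phi> = (1 - \<theta>) / L"
    and \<eta>_eq: "\<eta> = (1 - \<theta>) / (L * \<theta> * (1 + 2 * sqrt \<Delta> * \<tau>t))"
    and S_eq: "S = nat \<lceil>2 * \<omega> * sqrt (\<kappa> / real m * (1 + 2 * sqrt \<Delta> * \<tau>t))\<rceil>"
  shows "real S \<le> epochs_const \<omega> c\<^sub>1 C * max 1 (sqrt (\<kappa> / real n)) \<and>
    (\<forall>\<epsilon>>0. \<forall>x0. \<exists>R.
       real R \<le> rounds_const \<omega> * max 1 (ln ((mean_fun n f x0 - mean_fun n f xstar) / \<epsilon>)) \<and>
       real (R * S * (n + 2 * m)) \<le> oracle_const \<omega> c\<^sub>1 c\<^sub>2 C * (max (real n) (sqrt (\<kappa> * real n))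
           * max 1 (ln ((mean_fun n f x0 - mean_fun n f xstar) / \<epsilon>))) \<and>
       (\<forall>(M :: 'w measure) \<F> idx pick J zhat yhat G z xt x.
          AS_Acc_SVRG M f n T m \<tau> \<theta> \<phi> \<eta> S R x0 \<F> idx pick J zhat yhat G z xt x \<longrightarrow>
          integrable M (\<lambda>\<xi>. mean_fun n f (x R \<xi>)) \<and>
          (\<integral>\<xi>. mean_fun n f (x R \<xi>) \<partial>M) - mean_fun n f xstar \<le> \<epsilon>))"
proof -
  interpret sparse_convex_sum f n T L
    by unfold_locales (fact cover convex smooth supp L_pos)+
  define b where "b = 1 + 2 * sqrt \<Delta> * \<tau>t"
  define q where "q = sqrt (\<kappa> * b) / sqrt (real m)"
  have \<kappa>: "\<kappa> > 0" using L_pos \<mu>_pos by (simp add: \<kappa>_eq)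
  have \<Delta>: "\<Delta> > 0" by (simp add: \<Delta>_eq max_overlap_pos)
  have n: "real n > 0" using n_pos by simp
  have m: "real m > 0"
    using mult_pos_pos[OF m_Theta(1) n] m_Theta(2) by linarith
  have \<tau>t: "\<tau>t \<ge> 0" using \<tau>t_ge by (rule order_trans[rotated]) simp
  have b1: "b \<ge> 1" using \<Delta> \<tau>t by (simp add: b_def)
  have q: "q > 0" using \<kappa> b1 m by (simp add: q_def)
  have \<theta>_q: "\<theta> = 1 / (q + 1)"
    unfolding \<theta>_eq q_def b_def[symmetric] using m by (simp add: field_simps)
  have \<theta>: "0 < \<theta>" "\<theta> \<le> 1" and q_eq: "(1 - \<theta>) / \<theta> = q"
    unfolding \<theta>_q using q by (simp_all add: field_simps)
  have \<eta>_q: "\<eta> = q / (L * b)"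
    using q_eq unfolding \<eta>_eq b_def[symmetric] by (metis divide_divide_eq_left mult.assoc mult.commute)
  have \<eta>: "\<eta> > 0" using q L_pos b1 by (simp add: \<eta>_q)
  have \<eta>_b: "\<eta> * b * L * \<theta> = 1 - \<theta>"
    using \<theta> L_pos b1 by (simp add: \<eta>_q q_eq[symmetric])
  have \<phi>_L: "\<phi> * L = 1 - \<theta>" using L_pos by (simp add: \<phi>_eq)
  have b_ge: "b \<ge> 1 + 2 * sqrt (max_overlap n T) * real \<tau>"
    unfolding b_def \<Delta>_eq[symmetric] using \<Delta> \<tau>t_ge by (simp add: mult_left_mono)
  have q_sqrt: "q = sqrt (\<kappa> / real m * b)"
    by (simp add: q_def real_sqrt_divide[symmetric])
  then have S_q: "S = nat \<lceil>2 * \<omega> * q\<rceil>" unfolding S_eq b_def[symmetric] by simp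
  have S_ge: "real S \<ge> 2 * \<omega> * q" unfolding S_q by linarith
  have "2 * \<omega> * q > 0" using q \<omega>_gt by simp
  with S_ge have S: "real S > 0" by linarith
  \<comment> \<open>The choice of \<open>\<theta>\<close> amounts to
    \<open>q * q = \<kappa> * b / m\<close>, which makes the share of the initial distance in the
    rate equal to the share \<open>q\<close> of the snapshot gap.\<close>
  have eq_q: "1 / (\<eta> * real m * \<mu>) = q"
  proof -
    have "q * q = \<kappa> * b / real m"
      using \<kappa> b1 m by (simp add: q_def)
    then have "q * q * real m * \<mu> = L * b"
      using m \<mu>_pos by (simp add: \<kappa>_eq field_simps)
    then show ?thesis
      unfolding \<eta>_q using q L_pos b1 m \<mu>_pos by (simp add: field_simps)
  qed
  have rate: "(1 / real S) * ((1 - \<theta>) / \<theta> + 1 / (\<eta> * real m * \<mu>)) \<le> 1 / \<omega>"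
    unfolding q_eq eq_q using S_ge S \<omega>_gt by (simp add: field_simps)
  have sqrt_\<tau>t: "sqrt \<Delta> * \<tau>t \<le> C * max (real n / \<kappa>) 1"
    using mult_left_mono[OF \<tau>t_O, of "sqrt \<Delta>"] \<Delta> by simp
  \<comment> \<open>The sign of \<open>C\<close> is forced by
    \<open>0 \<le> sqrt \<Delta> * \<tau>t\<close> together with its upper bound.\<close>
  have "C \<ge> 0"
  proof (rule ccontr)
    assume "\<not> C \<ge> 0"
    then have "C * max (real n / \<kappa>) 1 < 0" by (intro mult_neg_pos) auto
    moreover have "0 \<le> sqrt \<Delta> * \<tau>t" using \<Delta> \<tau>t by simp
    ultimately show False using sqrt_\<tau>t by linarith
  qed
  then have S_bound: "real S \<le> epochs_const \<omega> c\<^sub>1 C * max 1 (sqrt (\<kappa> / real n))"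
    unfolding S_eq b_def[symmetric] using \<kappa> m_Theta n_pos \<omega>_gt b1 sqrt_\<tau>t
    by (intro epochs_bound) (auto simp: b_def)
  show ?thesis
  proof (intro conjI allI impI S_bound)
    fix \<epsilon> :: real and x0 :: "real ^ 'd"
    assume "\<epsilon> > 0"
    define g where "g = F x0 - F xstar"
    \<comment> \<open>The number of rounds is fixed from \<open>\<epsilon>\<close> and
      \<open>x0\<close> before any run is considered, so it serves all probability spaces and all
      delay patterns at once.\<close>
    obtain R where R: "real R \<le> rounds_const \<omega> * max 1 (ln (g / \<epsilon>))" "(1 / \<omega>) ^ R * g \<le> \<epsilon>"
      using restart_number[OF \<omega>_gt \<open>\<epsilon> > 0\<close>] by blast
    have "integrable M (\<lambda>\<xi>. F (x R \<xi>)) \<and> (\<integral>\<xi>. F (x R \<xi>) \<partial>M) - F xstar \<le> \<epsilon>"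
      if "AS_Acc_SVRG M f n T m \<tau> \<theta> \<phi> \<eta> S R x0 \<F> idx pick J zhat yhat G z xt x"
      for M :: "'w measure" and \<F> idx pick J zhat yhat G z xt x
    proof -
      interpret AS_Acc_SVRG M f n T m \<tau> \<theta> \<phi> \<eta> S R x0 \<F> idx pick J zhat yhat G z xt x by (rule that)
      interpret convex_run M f n T m \<tau> \<theta> \<phi> \<eta> S R x0 \<F> idx pick J zhat yhat G z xt x L
        by unfold_locales (use S m in simp_all)
      have "integrable M (\<lambda>\<xi>. F (x R \<xi>))"
        by (rule integrable_F[OF finite_measure_axioms sq_integrable_x]) simp
      moreover have "(\<integral>\<xi>. F (x R \<xi>) \<partial>M) - F xstar \<le> (1 / \<omega>) ^ R * g"
        unfolding g_def
        by (rule restart_bound[OF \<theta> \<eta> \<eta>_b \<phi>_L b_ge \<mu>_pos growth rate order_refl])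
      ultimately show ?thesis using R(2) by linarith
    qed
    moreover have "real (R * S * (n + 2 * m)) \<le> oracle_const \<omega> c\<^sub>1 c\<^sub>2 C * (max (real n) (sqrt (\<kappa> * real n))
           * max 1 (ln (g / \<epsilon>)))"
      unfolding oracle_const_def by (rule oracle_bound[OF n_pos \<kappa> R(1) S_bound m_Theta(3)])
    ultimately show "\<exists>R.
       real R \<le> rounds_const \<omega> * max 1 (ln ((mean_fun n f x0 - mean_fun n f xstar) / \<epsilon>)) \<and>
       real (R * S * (n + 2 * m)) \<le> oracle_const \<omega> c\<^sub>1 c\<^sub>2 C * (max (real n) (sqrt (\<kappa> * real n))
           * max 1 (ln ((mean_fun n f x0 - mean_fun n f xstar) / \<epsilon>))) \<and>
       (\<forall>(M :: 'w measure) \<F> idx pick J zhat yhat G z xt x.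
          AS_Acc_SVRG M f n T m \<tau> \<theta> \<phi> \<eta> S R x0 \<F> idx pick J zhat yhat G z xt x \<longrightarrow>
          integrable M (\<lambda>\<xi>. mean_fun n f (x R \<xi>)) \<and>
          (\<integral>\<xi>. mean_fun n f (x R \<xi>) \<partial>M) - mean_fun n f xstar \<le> \<epsilon>)"
      using R(1) unfolding g_def by blast
  qed
qed

end
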